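(* Assume that one of the hypotheses (Sub), (Sup-1), (Sup-0), (Crit-1), (Crit-2), (Crit-3) described in the context holds. Then for each $m\in\mathbb N$, the lexicographically ordered cycle lengths $L_1,\dots,L_m$ are asymptotically independent as $N\to\infty$ and, for any $\ell_1,\dots,\ell_m\in\mathbb N$, $$\lim_{N\to\infty}\mathbb P_N\{L_1=\ell_1,\dots,L_m=\ell_m\}=\prod_{j=1}^m\kappa_{\ell_j}r_*^{\ell_j}.$$
   Context: Model: for $N\in\mathbb N$, $S_N$ is the symmetric group on $\{1,\dots,N\}$; for $\sigma\in S_N$, $C_j=C_j(\sigma)$ is the number of cycles of length $j$ in $\sigma$. Given sequences of nonnegative reals $(\theta_j)_{j\ge1}$, $(\kappa_j)_{j\ge1}$, the probability measure $\mathbb P_N$ on $S_N$ is $\mathbb P_N(\sigma)=\frac{1}{N!H_N}\prod_{j=1}^N(\theta_j+N\kappa_j)^{C_j}$ with $H_N=\frac1{N!}\sum_{\sigma\in S_N}\prod_{j=1}^N(\theta_j+N\kappa_j)^{C_j}$. Lexicographic ordering: $L_1(\sigma)$ is the length of the cycle of $\sigma$ containing $1$, $L_2(\sigma)$ the length of the cycle containing the smallest element not in the first cycle, and so on. Generating functions: $g_\theta(z)=\sum_{j\ge1}\theta_jz^j/j$, $g_\kappa(z)=\sum_{j\ge1}\kappa_jz^j/j$. For a function $g$, $g^{\{n\}}(z):=z^n g^{(n)}(z)$. $R\in(0,\infty]$ is the radius of convergence of $g_\kappa$, and $g_\kappa^{\{n\}}(R):=\lim_{r\uparrow R}g_\kappa^{\{n\}}(r)\in[0,\infty]$.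 Standing assumption: $(\kappa_j)$ is non-arithmetic (there is no integer $j_0>1$ such that $\kappa_j\ne0$ implies that $j_0$ divides $j$) and $\kappa_j>0$ for some $j\ge2$. For $\eta>0$, $\varphi\in(0,\pi/2)$, $\Delta_0=\{z\in\mathbb C:|z|<R|1+\eta e^{i\varphi}|,\ z\ne R,\ |\arg(z-R)|>\varphi\}$; "holomorphic in some $\Delta_0$" means for some such $\eta,\varphi$. Logarithms and non-integer powers of $1-z/R$ use principal branches. Hypotheses: (Sub) $g_\theta,g_\kappa$ both have radius of convergence $R>0$ and $1<g_\kappa^{\{1\}}(R)\le\infty$. (Sup-1) $g_\theta,g_\kappa$ both have radius of convergence $R>0$, are holomorphic in some $\Delta_0$, $g_\kappa^{\{1\}}(R)<1$, and as $z\to R$, $z\in\Delta_0$: $g_\theta(z)=-\theta^*\log(1-z/R)+O((1-z/R)^\delta)$ and $g_\kappa(z)=g_\kappa(R)-g_\kappa^{\{1\}}(R)(1-z/R)+O((1-z/R)^{1+\delta})$, for some $\theta^*>0$, $\delta>0$. (Sup-0) $g_\kappa$ has radius of convergence $R>0$ and is holomorphic in some $\Delta_0$, $g_\kappa^{\{1\}}(R)<1$, there is a non-integer $s>1$ with $g_\kappa^{\{n\}}(R)<\infty$ for all integers $n<s$ and $g_\kappa^{\{n\}}(R)=\infty$ for $n>s$, and as $z\to R$, $z\in\Delta_0$, $g_\kappa(z)=\sum_{0\le n<s}\frac{(-1)^ng_\kappa^{\{n\}}(R)}{n!}(1-z/R)^n+a_s(1-z/R)^s+O((1-z/R)^{s+\delta})$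 with $a_s>0$, $\delta>0$; $g_\theta$ is holomorphic in $\Delta_0$ and regular (holomorphic in a neighbourhood of) at $z=R$. (Crit-1) $g_\theta,g_\kappa$ both have radius of convergence $R>0$, $g_\theta(R)<\infty$, $g_\kappa(R)<\infty$, $g_\kappa^{\{1\}}(R)=1$, $0<g_\kappa^{\{2\}}(R)<\infty$. (Crit-2) $g_\theta,g_\kappa$ both have radius of convergence $R>0$ and are holomorphic in some $\Delta_0$, $g_\kappa^{\{1\}}(R)=1$, $0<g_\kappa^{\{2\}}(R)<\infty$, and as $z\to R$, $z\in\Delta_0$: $g_\theta(z)=-\theta^*\log(1-z/R)+O((1-z/R)^\delta)$ with $\theta^*\ge0$, $\delta>0$, and $g_\kappa(z)=g_\kappa(R)-(1-z/R)+\frac12 g_\kappa^{\{2\}}(R)(1-z/R)^2+O((1-z/R)^{2+\delta})$. (Crit-3) as (Crit-2) but without the condition on $g_\kappa^{\{2\}}(R)$ and with the expansion of $g_\kappa$ replaced by $g_\kappa(z)=g_\kappa(R)-(1-z/R)+a_s(1-z/R)^s+O((1-z/R)^{s+\delta})$ with $s\in(1,2)$, $a_s>0$. Definition of $r_*$: if $g_\kappa^{\{1\}}(R)\ge1$, $r_*=r_1$, the unique $r\in(0,R]$ with $g_\kappa^{\{1\}}(r)=1$; if $g_\kappa^{\{1\}}(R)<1$, $r_*=R$. *)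

theory Defs
  imports "HOL-Analysis.Analysis" "HOL-Combinatorics.Permutations" "HOL-Library.Landau_Symbols"
begin

definition cyc :: "(nat \<Rightarrow> nat) \<Rightarrow> nat \<Rightarrow> nat set" where
  "cyc \<sigma> x = {(\<sigma> ^^ k) x | k. True}"

definition cycle_count :: "nat \<Rightarrow> (nat \<Rightarrow> nat) \<Rightarrow> nat \<Rightarrow> nat" where
  "cycle_count N \<sigma> j = card {c. \<exists>x\<in>{1..N}. c = cyc \<sigma> x \<and> card c = j}"

definition weight :: "(nat \<Rightarrow> real) \<Rightarrow> (nat \<Rightarrow> real) \<Rightarrow> nat \<Rightarrow> (nat \<Rightarrow> nat) \<Rightarrow> real" where
  "weight \<theta> \<kappa> N \<sigma> = (\<Prod>j=1..N. (\<theta> j + real N * \<kappa> j) ^ cycle_count N \<sigma> j)"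

definition H :: "(nat \<Rightarrow> real) \<Rightarrow> (nat \<Rightarrow> real) \<Rightarrow> nat \<Rightarrow> real" where
  "H \<theta> \<kappa> N = (\<Sum>\<sigma>\<in>{\<sigma>. \<sigma> permutes {1..N}}. weight \<theta> \<kappa> N \<sigma>) / fact N"

definition PN :: "(nat \<Rightarrow> real) \<Rightarrow> (nat \<Rightarrow> real) \<Rightarrow> nat \<Rightarrow> ((nat \<Rightarrow> nat) \<Rightarrow> bool) \<Rightarrow> real" where
  "PN \<theta> \<kappa> N E = (\<Sum>\<sigma>\<in>{\<sigma>. \<sigma> permutes {1..N} \<and> E \<sigma>}. weight \<theta> \<kappa> N \<sigma> / (fact N * H \<theta> \<kappa> N))"

fun lex_cycles :: "nat \<Rightarrow> (nat \<Rightarrow> nat) \<Rightarrow> nat \<Rightarrow> nat set" where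
  "lex_cycles N \<sigma> 0 = {}"
| "lex_cycles N \<sigma> (Suc k) =
     (if {1..N} - lex_cycles N \<sigma> k = {} then lex_cycles N \<sigma> k
      else lex_cycles N \<sigma> k \<union> cyc \<sigma> (LEAST x. x \<in> {1..N} - lex_cycles N \<sigma> k))"

(* L_k(sigma) for k >= 1: length of the cycle containing the smallest element not in the
   first k-1 cycles; 0 if sigma has fewer than k cycles (so L_k = l with l >= 1 forces existence) *)
definition lexL :: "nat \<Rightarrow> (nat \<Rightarrow> nat) \<Rightarrow> nat \<Rightarrow> nat" where
  "lexL N \<sigma> k =
     (if {1..N} - lex_cycles N \<sigma> (k - 1) = {} then 0
      else card (cyc \<sigma> (LEAST x. x \<in> {1..N} - lex_cycles N \<sigma> (k - 1))))"

(* coefficients theta_j / j of g_theta (coefficient 0 at j = 0) *)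
definition gcoef :: "(nat \<Rightarrow> real) \<Rightarrow> nat \<Rightarrow> complex" where
  "gcoef a j = complex_of_real (a j / real j)"

definition gfun :: "(nat \<Rightarrow> real) \<Rightarrow> complex \<Rightarrow> complex" where
  "gfun a z = (\<Sum>j. gcoef a j * z ^ j)"

definition grad :: "(nat \<Rightarrow> real) \<Rightarrow> ereal" where
  "grad a = conv_radius (gcoef a)"

definition gop :: "(nat \<Rightarrow> real) \<Rightarrow> nat \<Rightarrow> real \<Rightarrow> real" where
  "gop a n r = Re (complex_of_real r ^ n * (deriv ^^ n) (gfun a) (complex_of_real r))"

(* g^{n}(R) = lim_{r uparrow R} g^{n}(r) in [0,\<infinity>]; as g^{n} is nondecreasing on (0,R)
   for nonnegative coefficients, this limit is the supremum *)
definition gopR :: "(nat \<Rightarrow> real) \<Rightarrow> nat \<Rightarrow> ereal" where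
  "gopR a n = (SUP r\<in>{r. 0 < r \<and> ereal r < grad a}. ereal (gop a n r))"

definition Delta0 :: "real \<Rightarrow> real \<Rightarrow> real \<Rightarrow> complex set" where
  "Delta0 R \<eta> \<phi> = {z. cmod z < R * cmod (1 + complex_of_real \<eta> * exp (\<i> * complex_of_real \<phi>))
                     \<and> z \<noteq> complex_of_real R \<and> \<bar>Arg (z - complex_of_real R)\<bar> > \<phi>}"

definition holo_ext :: "(nat \<Rightarrow> real) \<Rightarrow> complex set \<Rightarrow> (complex \<Rightarrow> complex) \<Rightarrow> bool" where
  "holo_ext a D G \<longleftrightarrow> 0 < grad a \<and> G holomorphic_on D \<and>
     (\<forall>z\<in>D. ereal (cmod z) < grad a \<longrightarrow> G z = gfun a z)"

abbreviation (input) "w R z \<equiv> 1 - z / complex_of_real R"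

definition hyp_Sub :: "(nat \<Rightarrow> real) \<Rightarrow> (nat \<Rightarrow> real) \<Rightarrow> bool" where
  "hyp_Sub \<theta> \<kappa> \<longleftrightarrow> grad \<theta> = grad \<kappa> \<and> 0 < grad \<kappa> \<and> 1 < gopR \<kappa> 1"

definition hyp_Sup1 :: "(nat \<Rightarrow> real) \<Rightarrow> (nat \<Rightarrow> real) \<Rightarrow> bool" where
  "hyp_Sup1 \<theta> \<kappa> \<longleftrightarrow> (\<exists>R::real. grad \<theta> = ereal R \<and> grad \<kappa> = ereal R \<and> 0 < R \<and>
     gopR \<kappa> 1 < 1 \<and>
     (\<exists>\<eta> \<phi> G\<theta> G\<kappa>. 0 < \<eta> \<and> 0 < \<phi> \<and> \<phi> < pi / 2 \<and>
        holo_ext \<theta> (Delta0 R \<eta> \<phi>) G\<theta> \<and> holo_ext \<kappa> (Delta0 R \<eta> \<phi>) G\<kappa> \<and>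
        (\<exists>\<theta>s \<delta>. 0 < \<theta>s \<and> 0 < \<delta> \<and>
          (\<lambda>z. G\<theta> z - (- complex_of_real \<theta>s * Ln (w R z)))
             \<in> O[at (complex_of_real R) within Delta0 R \<eta> \<phi>](\<lambda>z. w R z powr complex_of_real \<delta>) \<and>
          (\<lambda>z. G\<kappa> z - (complex_of_real (real_of_ereal (gopR \<kappa> 0))
                         - complex_of_real (real_of_ereal (gopR \<kappa> 1)) * w R z))
             \<in> O[at (complex_of_real R) within Delta0 R \<eta> \<phi>](\<lambda>z. w R z powr complex_of_real (1 + \<delta>)))))"

definition hyp_Sup0 :: "(nat \<Rightarrow> real) \<Rightarrow> (nat \<Rightarrow> real) \<Rightarrow> bool" where
  "hyp_Sup0 \<theta> \<kappa> \<longleftrightarrow> (\<exists>R::real. grad \<kappa> = ereal R \<and> 0 < R \<and> gopR \<kappa> 1 < 1 \<and>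
     (\<exists>\<eta> \<phi> G\<theta> G\<kappa> s. 0 < \<eta> \<and> 0 < \<phi> \<and> \<phi> < pi / 2 \<and>
        holo_ext \<kappa> (Delta0 R \<eta> \<phi>) G\<kappa> \<and>
        s \<notin> \<int> \<and> 1 < s \<and>
        (\<forall>n::nat. real n < s \<longrightarrow> gopR \<kappa> n < \<infinity>) \<and>
        (\<forall>n::nat. real n > s \<longrightarrow> gopR \<kappa> n = \<infinity>) \<and>
        (\<exists>a\<^sub>s \<delta>. 0 < a\<^sub>s \<and> 0 < \<delta> \<and>
          (\<lambda>z. G\<kappa> z - ((\<Sum>n | real n < s. (-1) ^ n * complex_of_real (real_of_ereal (gopR \<kappa> n))
                                               / fact n * w R z ^ n)
                        + complex_of_real a\<^sub>s * w R z powr complex_of_real s))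
             \<in> O[at (complex_of_real R) within Delta0 R \<eta> \<phi>](\<lambda>z. w R z powr complex_of_real (s + \<delta>))) \<and>
        holo_ext \<theta> (Delta0 R \<eta> \<phi>) G\<theta> \<and>
        (\<exists>\<epsilon>>0. G\<theta> holomorphic_on (Delta0 R \<eta> \<phi> \<union> ball (complex_of_real R) \<epsilon>))))"

definition hyp_Crit1 :: "(nat \<Rightarrow> real) \<Rightarrow> (nat \<Rightarrow> real) \<Rightarrow> bool" where
  "hyp_Crit1 \<theta> \<kappa> \<longleftrightarrow> (\<exists>R::real. grad \<theta> = ereal R \<and> grad \<kappa> = ereal R \<and> 0 < R \<and>
     gopR \<theta> 0 < \<infinity> \<and> gopR \<kappa> 0 < \<infinity> \<and> gopR \<kappa> 1 = 1 \<and> 0 < gopR \<kappa> 2 \<and> gopR \<kappa> 2 < \<infinity>)"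

definition hyp_Crit2 :: "(nat \<Rightarrow> real) \<Rightarrow> (nat \<Rightarrow> real) \<Rightarrow> bool" where
  "hyp_Crit2 \<theta> \<kappa> \<longleftrightarrow> (\<exists>R::real. grad \<theta> = ereal R \<and> grad \<kappa> = ereal R \<and> 0 < R \<and>
     gopR \<kappa> 1 = 1 \<and> 0 < gopR \<kappa> 2 \<and> gopR \<kappa> 2 < \<infinity> \<and>
     (\<exists>\<eta> \<phi> G\<theta> G\<kappa>. 0 < \<eta> \<and> 0 < \<phi> \<and> \<phi> < pi / 2 \<and>
        holo_ext \<theta> (Delta0 R \<eta> \<phi>) G\<theta> \<and> holo_ext \<kappa> (Delta0 R \<eta> \<phi>) G\<kappa> \<and>
        (\<exists>\<theta>s \<delta>. 0 \<le> \<theta>s \<and> 0 < \<delta> \<and>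
          (\<lambda>z. G\<theta> z - (- complex_of_real \<theta>s * Ln (w R z)))
             \<in> O[at (complex_of_real R) within Delta0 R \<eta> \<phi>](\<lambda>z. w R z powr complex_of_real \<delta>) \<and>
          (\<lambda>z. G\<kappa> z - (complex_of_real (real_of_ereal (gopR \<kappa> 0)) - w R z
                         + complex_of_real (real_of_ereal (gopR \<kappa> 2) / 2) * w R z ^ 2))
             \<in> O[at (complex_of_real R) within Delta0 R \<eta> \<phi>](\<lambda>z. w R z powr complex_of_real (2 + \<delta>)))))"

definition hyp_Crit3 :: "(nat \<Rightarrow> real) \<Rightarrow> (nat \<Rightarrow> real) \<Rightarrow> bool" where
  "hyp_Crit3 \<theta> \<kappa> \<longleftrightarrow> (\<exists>R::real. grad \<theta> = ereal R \<and> grad \<kappa> = ereal R \<and> 0 < R \<and>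
     gopR \<kappa> 1 = 1 \<and>
     (\<exists>\<eta> \<phi> G\<theta> G\<kappa>. 0 < \<eta> \<and> 0 < \<phi> \<and> \<phi> < pi / 2 \<and>
        holo_ext \<theta> (Delta0 R \<eta> \<phi>) G\<theta> \<and> holo_ext \<kappa> (Delta0 R \<eta> \<phi>) G\<kappa> \<and>
        (\<exists>\<theta>s \<delta> s a\<^sub>s. 0 \<le> \<theta>s \<and> 0 < \<delta> \<and> 1 < s \<and> s < 2 \<and> 0 < a\<^sub>s \<and>
          (\<lambda>z. G\<theta> z - (- complex_of_real \<theta>s * Ln (w R z)))
             \<in> O[at (complex_of_real R) within Delta0 R \<eta> \<phi>](\<lambda>z. w R z powr complex_of_real \<delta>) \<and>
          (\<lambda>z. G\<kappa> z - (complex_of_real (real_of_ereal (gopR \<kappa> 0)) - w R z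
                         + complex_of_real a\<^sub>s * w R z powr complex_of_real s))
             \<in> O[at (complex_of_real R) within Delta0 R \<eta> \<phi>](\<lambda>z. w R z powr complex_of_real (s + \<delta>)))))"

definition gop1_ext :: "(nat \<Rightarrow> real) \<Rightarrow> real \<Rightarrow> ereal" where
  "gop1_ext \<kappa> r = (if ereal r < grad \<kappa> then ereal (gop \<kappa> 1 r) else gopR \<kappa> 1)"

definition rstar :: "(nat \<Rightarrow> real) \<Rightarrow> real" where
  "rstar \<kappa> = (if gopR \<kappa> 1 \<ge> 1
      then (THE r. 0 < r \<and> ereal r \<le> grad \<kappa> \<and> gop1_ext \<kappa> r = 1)
      else real_of_ereal (grad \<kappa>))"

end

theory Submission
  imports Defs "HOL-Combinatorics.Orbits" "HOL-Complex_Analysis.Complex_Analysis"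
    "HOL-Real_Asymp.Real_Asymp"
begin

text \<open>
  Removing the first cycles of a permutation turns the probability into
  \<open>\<Prod>\<^sub>j (\<theta> + N \<kappa>)(\<ell>\<^sub>j) / (N - \<ell>\<^sub>1 - \<dots> - \<ell>\<^sub>j\<^sub>-\<^sub>1)\<close> times \<open>h (N - \<Sum>\<ell>\<^sub>j) / h N\<close>, where \<open>h n\<close> is the
  coefficient of \<open>z\<^sup>n\<close> in \<open>exp (g\<^sub>\<theta> + N g\<^sub>\<kappa>)\<close>. Hence it suffices that \<open>h (n - d) / h n\<close> tends to
  \<open>r\<^sub>*\<^sup>d\<close> when \<open>n - N\<close> is constant. No precise asymptotics of \<open>h\<close> are needed for this:

  \<^item> \<open>\<kappa>\<^sub>J / J * h (n - J) / h n\<close> is, up to a factor tending to 1, the mean of \<open>C\<^sub>J / N\<close>. By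
    Jensen's inequality, this mean is controlled by the effect on \<open>ln h n\<close> of tilting the weight of
    \<open>J\<close>-cycles by a factor \<open>e\<^sup>t\<close>, so the limit \<open>g\<^sub>\<kappa> r\<^sub>* - ln r\<^sub>*\<close> of \<open>ln (h N) / N\<close>
    (an upper bound for the tilted and a lower bound for the original weights) determines its limit.
  \<^item> The upper bound is the saddle point bound \<open>h n \<le> r\<^sup>-\<^sup>n exp (g\<^sub>\<theta> r + N g\<^sub>\<kappa> r)\<close> for \<open>r < r\<^sub>*\<close>.
  \<^item> The lower bound comes from superadditivity of \<open>(k, n) \<mapsto> ln [z\<^sup>n] exp (k g\<^sub>\<kappa>)\<close>: a supporting
    line of slope \<open>- ln \<rho>\<close> at \<open>k = n\<close> shows that the growth rate on the diagonal is at least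
    \<open>g\<^sub>\<kappa> \<rho> - ln \<rho>\<close>, which is minimised over \<open>(0, R]\<close> by \<open>r\<^sub>*\<close>.
  \<^item> This gives the ratio limit for all \<open>J\<close> with \<open>\<kappa>\<^sub>J > 0\<close>; the \<open>d\<close> for which it holds form a
    subgroup of the integers, which is everything since \<open>\<kappa>\<close> is non-arithmetic.

  Consequently all six hypotheses enter only through the radii of convergence and the value of
  \<open>g\<^sub>\<kappa>\<^sup>{\<^sup>1\<^sup>}\<close> at \<open>R\<close>.
\<close>

section \<open>Coefficients of exponential generating functions\<close>

text \<open>\<open>cyc_gf a n\<close> is the coefficient of \<open>z ^ n\<close> in \<open>exp (\<Sum>j\<ge>1. a j * z ^ j / j)\<close>, so that
  \<open>H_N = cyc_gf (\<lambda>j. \<theta> j + N * \<kappa> j) N\<close>; the value \<open>a 0\<close> is irrelevant.\<close>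
fun cyc_gf :: "(nat \<Rightarrow> real) \<Rightarrow> nat \<Rightarrow> real" where
  "cyc_gf a n = (if n = 0 then 1 else (\<Sum>l=1..n. a l * cyc_gf a (n - l)) / real n)"

declare cyc_gf.simps [simp del]

lemma cyc_gf_0 [simp]: "cyc_gf a 0 = 1"
  by (subst cyc_gf.simps) simp

lemma cyc_gf_rec: "real n * cyc_gf a n = (\<Sum>l=1..n. a l * cyc_gf a (n - l))"
  by (cases "n = 0") (simp, subst cyc_gf.simps, simp)

lemma cyc_gf_unique:
  assumes "f 0 = 1" "\<And>n. real n * f n = (\<Sum>l=1..n. a l * f (n - l))"
  shows "f n = cyc_gf a n"
proof (induction n rule: less_induct)
  case (less n)
  show ?case
  proof (cases "n = 0")
    case False
    have "real n * f n = real n * cyc_gf a n"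
      unfolding cyc_gf_rec assms(2) using less False by (intro sum.cong) auto
    with False show ?thesis by simp
  qed (use assms in simp)
qed

lemma cyc_gf_cong:
  assumes "\<And>l. 1 \<le> l \<Longrightarrow> l \<le> n \<Longrightarrow> a l = v l"
  shows "cyc_gf a n = cyc_gf v n"
  using assms
proof (induction n rule: less_induct)
  case (less n)
  have "(\<Sum>l=1..n. a l * cyc_gf a (n - l)) = (\<Sum>l=1..n. v l * cyc_gf v (n - l))"
    by (intro sum.cong refl arg_cong2[of _ _ _ _ "(*)"] less) auto
  then show ?case by (subst (1 2) cyc_gf.simps) simp
qed

lemma cyc_gf_nonneg:
  assumes "\<And>l. 0 \<le> a l"
  shows "0 \<le> cyc_gf a n"
proof (induction n rule: less_induct)
  case (less n)
  then show ?case
    by (subst cyc_gf.simps) (auto intro!: divide_nonneg_nonneg sum_nonneg mult_nonneg_nonneg assms)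
qed

lemma cyc_gf_mono:
  assumes "\<And>l. 0 \<le> a l" "\<And>l. a l \<le> v l"
  shows "cyc_gf a n \<le> cyc_gf v n"
proof (induction n rule: less_induct)
  case (less n)
  have "0 \<le> v l" for l using assms order_trans by blast
  have "(\<Sum>l=1..n. a l * cyc_gf a (n - l)) \<le> (\<Sum>l=1..n. v l * cyc_gf v (n - l))"
    by (intro sum_mono mult_mono less assms cyc_gf_nonneg \<open>0 \<le> v _\<close>) auto
  then show ?case by (subst (1 2) cyc_gf.simps) (simp add: divide_right_mono)
qed

text \<open>Comparing coefficients, the recursion is the formal equation \<open>z F' = A F\<close>
  satisfied by the exponential. \<open>A\<close> has constant term 0 because the recursion starts at
  \<open>l = 1\<close>.\<close>

lemma cyc_gf_fps_ode:
  fixes F :: "real fps"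
  shows "(\<forall>n. real n * fps_nth F n = (\<Sum>l=1..n. a l * fps_nth F (n - l)))
    \<longleftrightarrow> fps_X * fps_deriv F = Abs_fps (\<lambda>j. if j = 0 then 0 else a j) * F"
proof -
  have "(\<Sum>i=0..n. (if i = 0 then 0 else a i) * fps_nth F (n - i))
      = (\<Sum>l=1..n. a l * fps_nth F (n - l))" for n
    by (simp add: sum.atLeast_Suc_atMost)
  moreover have "fps_nth (fps_X * fps_deriv F) n = real n * fps_nth F n" for n
    by (cases n) auto
  ultimately show ?thesis
    by (simp add: fps_eq_iff fps_mult_nth)
qed

text \<open>The exponential turns sums into products: by the Leibniz rule the product series solves
  the equation for \<open>a + v\<close>, and the recursion has only one solution.\<close>

lemma cyc_gf_add:
  "cyc_gf (\<lambda>j. a j + v j) n = (\<Sum>i\<le>n. cyc_gf a i * cyc_gf v (n - i))"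
proof -
  define F G where "F = Abs_fps (cyc_gf a)" and "G = Abs_fps (cyc_gf v)"
  let ?P = "\<lambda>a::nat \<Rightarrow> real. Abs_fps (\<lambda>j. if j = 0 then 0 else a j)"
  have F: "fps_X * fps_deriv F = ?P a * F" and G: "fps_X * fps_deriv G = ?P v * G"
    by (subst cyc_gf_fps_ode[symmetric], simp add: F_def G_def cyc_gf_rec)+
  have "fps_X * fps_deriv (F * G) = fps_X * fps_deriv F * G + F * (fps_X * fps_deriv G)"
    by (simp add: algebra_simps)
  also have "\<dots> = (?P a + ?P v) * (F * G)"
    unfolding F G by (simp add: algebra_simps)
  also have "?P a + ?P v = ?P (\<lambda>j. a j + v j)"
    by (simp add: fps_eq_iff)
  finally have "\<forall>n. real n * fps_nth (F * G) n
      = (\<Sum>l=1..n. (a l + v l) * fps_nth (F * G) (n - l))"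
    unfolding cyc_gf_fps_ode .
  then have "fps_nth (F * G) n = cyc_gf (\<lambda>j. a j + v j) n"
    by (intro cyc_gf_unique) (auto simp: F_def G_def)
  then show ?thesis
    by (simp add: F_def G_def fps_mult_nth atLeast0AtMost)
qed

lemma cyc_gf_supermult:
  assumes "\<And>l. 0 \<le> a l" "\<And>l. 0 \<le> v l"
  shows "cyc_gf a n * cyc_gf v m \<le> cyc_gf (\<lambda>j. a j + v j) (n + m)"
proof -
  have "cyc_gf a n * cyc_gf v (n + m - n) \<le> (\<Sum>i\<le>n + m. cyc_gf a i * cyc_gf v (n + m - i))"
    by (rule member_le_sum) (auto intro!: mult_nonneg_nonneg cyc_gf_nonneg assms)
  then show ?thesis by (simp add: cyc_gf_add)
qed

section \<open>Explicit exponentials and the saddle point bound\<close>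

lemma cyc_gf_zero: "cyc_gf (\<lambda>_. 0) n = (if n = 0 then 1 else 0)"
  by (subst cyc_gf.simps) simp

lemma cyc_gf_single:
  assumes j: "1 \<le> j"
  shows "cyc_gf (\<lambda>i. if i = j then u else 0) n
    = (if j dvd n then (u / real j) ^ (n div j) / fact (n div j) else 0)"
proof (rule cyc_gf_unique[symmetric])
  fix n
  let ?f = "\<lambda>n. if j dvd n then (u / real j) ^ (n div j) / fact (n div j) else 0"
  have "(\<Sum>l=1..n. (if l = j then u else 0) * ?f (n - l))
     = (\<Sum>l=1..n. if l = j then u * ?f (n - j) else 0)"
    by (intro sum.cong) auto
  also have "\<dots> = (if j \<le> n then u * ?f (n - j) else 0)"
    using j by (simp add: sum.delta)
  also have "\<dots> = real n * ?f n"
  proof (cases "j dvd n")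
    case True
    then obtain k where k: "n = j * k" by auto
    show ?thesis
    proof (cases k)
      case 0
      then show ?thesis using k j by simp
    next
      case (Suc k')
      have "n - j = j * k'" "j \<le> n" using k Suc by auto
      moreover define f where "f = u / real j"
      have "u = real j * f" using j by (simp add: f_def)
      ultimately show ?thesis using j Suc k
        by (simp add: f_def[symmetric] field_simps del: of_nat_Suc) (simp add: algebra_simps)
    qed
  next
    case False
    then show ?thesis using j by (auto simp: dvd_diff_nat dvd_minus_self)
  qed
  finally show "real n * ?f n = (\<Sum>l=1..n. (if l = j then u else 0) * ?f (n - l))" ..
qed simp

lemma cyc_gf_single_sums:
  assumes j: "1 \<le> j" and "0 \<le> u" "0 \<le> t"
  shows "(\<lambda>n. cyc_gf (\<lambda>i. if i = j then u else 0) n * t ^ n) sums exp (u * t ^ j / real j)"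
proof -
  let ?f = "\<lambda>n. cyc_gf (\<lambda>i. if i = j then u else 0) n * t ^ n"
  have "?f (j * k) = (u * t ^ j / real j) ^ k /\<^sub>R fact k" for k
    using j by (simp add: cyc_gf_single power_mult_distrib power_divide power_mult field_simps)
  then have "(\<lambda>k. ?f (j * k)) sums exp (u * t ^ j / real j)"
    using exp_converges[of "u * t ^ j / real j"] by simp
  moreover have "strict_mono (\<lambda>k. j * k)"
    using j by (auto simp: strict_mono_def)
  moreover have "?f n = 0" if "n \<notin> range (\<lambda>k. j * k)" for n
    using that j by (auto simp: cyc_gf_single elim!: dvdE)
  ultimately show ?thesis
    by (subst (asm) sums_mono_reindex)
qed

text \<open>Cutting the weights off at \<open>M\<close> leaves a polynomial exponent, so the series
  converges at every \<open>t\<close>. The induction multiplies in one factor at a time by a Cauchy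
  product.\<close>

lemma cyc_gf_trunc_sums:
  assumes a: "\<And>l. 0 \<le> a l" and t: "0 \<le> t"
  shows "(\<lambda>n. cyc_gf (\<lambda>i. if i \<le> M then a i else 0) n * t ^ n) sums
    exp (\<Sum>j=1..M. a j * t ^ j / real j)"
proof (induction M)
  case 0
  have "cyc_gf (\<lambda>i. if i \<le> 0 then a i else 0) n = cyc_gf (\<lambda>_. 0) n" for n
    by (rule cyc_gf_cong) auto
  then have "(\<lambda>n. cyc_gf (\<lambda>i. if i \<le> 0 then a i else 0) n * t ^ n) = (\<lambda>n. if n = 0 then 1 else 0)"
    by (auto simp: cyc_gf_zero)
  then show ?case using sums_single[of 0 "\<lambda>_. 1::real"] by simp
next
  case (Suc M)
  let ?a = "\<lambda>n. cyc_gf (\<lambda>i. if i \<le> M then a i else 0) n * t ^ n"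
  let ?b = "\<lambda>n. cyc_gf (\<lambda>i. if i = Suc M then a (Suc M) else 0) n * t ^ n"
  have b: "?b sums exp (a (Suc M) * t ^ Suc M / real (Suc M))"
    by (rule cyc_gf_single_sums) (use a t in auto)
  have nn: "0 \<le> ?a n" "0 \<le> ?b n" for n
    using a t by (auto intro!: mult_nonneg_nonneg cyc_gf_nonneg)
  have "(\<lambda>n. \<Sum>i\<le>n. ?a i * ?b (n - i)) sums ((\<Sum>n. ?a n) * (\<Sum>n. ?b n))"
    by (rule Cauchy_product_sums) (use Suc b nn in \<open>auto simp: sums_iff\<close>)
  moreover have "(\<Sum>i\<le>n. ?a i * ?b (n - i))
      = cyc_gf (\<lambda>i. if i \<le> Suc M then a i else 0) n * t ^ n" for n
  proof -
    have "(\<Sum>i\<le>n. ?a i * ?b (n - i)) = (\<Sum>i\<le>n. cyc_gf (\<lambda>i. if i \<le> M then a i else 0) i *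
         cyc_gf (\<lambda>i. if i = Suc M then a (Suc M) else 0) (n - i) * t ^ n)"
    proof (rule sum.cong)
      fix i assume "i \<in> {..n}"
      then have "t ^ n = t ^ i * t ^ (n - i)" by (simp flip: power_add)
      then show "?a i * ?b (n - i) = cyc_gf (\<lambda>i. if i \<le> M then a i else 0) i *
         cyc_gf (\<lambda>i. if i = Suc M then a (Suc M) else 0) (n - i) * t ^ n" by simp
    qed simp
    also have "\<dots> = cyc_gf (\<lambda>i. (if i \<le> M then a i else 0) + (if i = Suc M then a (Suc M) else 0)) n * t ^ n"
      by (simp add: cyc_gf_add sum_distrib_right)
    also have "cyc_gf (\<lambda>i. (if i \<le> M then a i else 0) + (if i = Suc M then a (Suc M) else 0)) n
       = cyc_gf (\<lambda>i. if i \<le> Suc M then a i else 0) n"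
      by (rule cyc_gf_cong) auto
    finally show ?thesis .
  qed
  moreover have "(\<Sum>n. ?a n) * (\<Sum>n. ?b n) = exp (\<Sum>j=1..Suc M. a j * t ^ j / real j)"
    using Suc b by (simp add: sums_iff exp_add)
  ultimately show ?case by simp
qed

text \<open>A nonnegative series dominates each of its terms. The cut-off at \<open>n\<close> does
  not change the coefficient of index \<open>n\<close> and keeps the exponent a finite sum.\<close>

lemma cyc_gf_upper:
  assumes a: "\<And>l. 0 \<le> a l" and t: "0 \<le> t"
  shows "cyc_gf a n * t ^ n \<le> exp (\<Sum>j=1..n. a j * t ^ j / real j)"
proof -
  let ?a = "\<lambda>k. cyc_gf (\<lambda>i. if i \<le> n then a i else 0) k * t ^ k"
  have "?a n \<le> exp (\<Sum>j=1..n. a j * t ^ j / real j)"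
  proof -
    have "?a sums exp (\<Sum>j=1..n. a j * t ^ j / real j)"
      by (rule cyc_gf_trunc_sums[OF a t])
    moreover have "0 \<le> ?a k" for k
      by (intro mult_nonneg_nonneg cyc_gf_nonneg zero_le_power) (use a t in auto)
    ultimately show ?thesis using sum_le_suminf[of ?a "{n}"] by (simp add: sums_iff)
  qed
  moreover have "cyc_gf (\<lambda>i. if i \<le> n then a i else 0) n = cyc_gf a n"
    by (rule cyc_gf_cong) auto
  ultimately show ?thesis by simp
qed

section \<open>Lexicographic cycle lengths\<close>

lemma cyc_eq_orbit:
  assumes "finite A" "\<sigma> permutes A"
  shows "cyc \<sigma> x = orbit \<sigma> x"
  unfolding cyc_def
  by (rule orbit_altdef_permutation[symmetric]) (use assms in \<open>auto simp: permutation_permutes\<close>)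

text \<open>The product runs over the cycles themselves, on an arbitrary finite set, so that
  deleting a cycle leaves an expression of the same kind.\<close>

definition perm_weight :: "(nat \<Rightarrow> real) \<Rightarrow> nat set \<Rightarrow> (nat \<Rightarrow> nat) \<Rightarrow> real" where
  "perm_weight a A \<sigma> = (\<Prod>c\<in>orbit \<sigma> ` A. a (card c))"

lemma orbit_permutes:
  assumes "finite A" "\<sigma> permutes A" "x \<in> A"
  shows "orbit \<sigma> x \<subseteq> A" "x \<in> orbit \<sigma> x" "finite (orbit \<sigma> x)"
proof -
  show "orbit \<sigma> x \<subseteq> A" using assms by (simp add: permutes_orbit_subset)
  then show "finite (orbit \<sigma> x)" using assms(1) finite_subset by blast
  show "x \<in> orbit \<sigma> x"
    using assms by (intro permutation_self_in_orbit) (auto simp: permutation_permutes)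
qed

lemma weight_eq_perm_weight:
  assumes \<sigma>: "\<sigma> permutes {1..N}"
  shows "weight \<theta> \<kappa> N \<sigma> = perm_weight (\<lambda>j. \<theta> j + real N * \<kappa> j) {1..N} \<sigma>"
proof -
  let ?C = "orbit \<sigma> ` {1..N}"
  let ?a = "\<lambda>j. \<theta> j + real N * \<kappa> j"
  have cc: "cycle_count N \<sigma> j = card {c \<in> ?C. card c = j}" for j
    unfolding cycle_count_def
    by (rule arg_cong[of _ _ card]) (auto simp: cyc_eq_orbit[OF _ \<sigma>])
  have "card c \<in> {1..N}" if "c \<in> ?C" for c
  proof -
    from that obtain x where x: "x \<in> {1..N}" "c = orbit \<sigma> x" by auto
    have "card c \<le> card {1..N}" "c \<noteq> {}" "finite c"
      using orbit_permutes[OF _ \<sigma> x(1)] x(2) card_mono[of "{1..N}" c] by auto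
    then show ?thesis by (auto simp: Suc_le_eq card_gt_0_iff)
  qed
  then have "perm_weight ?a {1..N} \<sigma> = (\<Prod>j\<in>{1..N}. \<Prod>c\<in>{c \<in> ?C. card c = j}. ?a (card c))"
    unfolding perm_weight_def by (intro prod.group[symmetric]) auto
  also have "\<dots> = weight \<theta> \<kappa> N \<sigma>"
    unfolding weight_def cc by (intro prod.cong) auto
  finally show ?thesis ..
qed

text \<open>Recursive form of the lexicographic ordering, suited to induction over the list: the
  cycle of the minimum is removed and the rest is treated likewise.\<close>

fun lex_lengths :: "nat set \<Rightarrow> (nat \<Rightarrow> nat) \<Rightarrow> nat list \<Rightarrow> bool" where
  "lex_lengths A \<sigma> [] = True"
| "lex_lengths A \<sigma> (l # ls) = (A \<noteq> {} \<and> card (orbit \<sigma> (Min A)) = l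
     \<and> lex_lengths (A - orbit \<sigma> (Min A)) \<sigma> ls)"

lemma lex_lengths_cong:
  assumes "finite A" "\<And>y. y \<in> A \<Longrightarrow> orbit \<sigma> y = orbit \<rho> y"
  shows "lex_lengths A \<sigma> ls = lex_lengths A \<rho> ls"
  using assms
proof (induction ls arbitrary: A)
  case (Cons l ls)
  show ?case
  proof (cases "A = {}")
    case False
    then have "orbit \<sigma> (Min A) = orbit \<rho> (Min A)" using Cons.prems by auto
    moreover have "lex_lengths (A - orbit \<rho> (Min A)) \<sigma> ls = lex_lengths (A - orbit \<rho> (Min A)) \<rho> ls"
      using Cons.prems by (intro Cons.IH) auto
    ultimately show ?thesis by simp
  qed simp
qed simp

lemma lexL_iff_lex_lengths:
  assumes \<sigma>: "\<sigma> permutes {1..N}" and l: "\<And>j. 1 \<le> j \<Longrightarrow> j \<le> m \<Longrightarrow> 1 \<le> l j"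
  shows "(\<forall>j\<in>{1..m}. lexL N \<sigma> j = l j) \<longleftrightarrow> lex_lengths {1..N} \<sigma> (map l [1..<Suc m])"
proof -
  \<comment> \<open>Generalised to the state after \<open>k\<close> cycles; the induction runs on
    the number \<open>m - k\<close> of cycles still to come.\<close>
  have "(\<forall>j\<in>{Suc k..m}. lexL N \<sigma> j = l j) \<longleftrightarrow>
      lex_lengths ({1..N} - lex_cycles N \<sigma> k) \<sigma> (map l [Suc k..<Suc m])" if "k \<le> m" for k
    using that
  proof (induction "m - k" arbitrary: k)
    case 0
    then show ?case by simp
  next
    case (Suc d)
    let ?A = "{1..N} - lex_cycles N \<sigma> k"
    have k: "k < m" using Suc by simp
    then have split: "{Suc k..m} = insert (Suc k) {Suc (Suc k)..m}" by auto
    have upt: "[Suc k..<Suc m] = Suc k # [Suc (Suc k)..<Suc m]"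
      using k by (simp add: upt_conv_Cons)
    show ?case
    proof (cases "?A = {}")
      case True
      \<comment> \<open>With no element left, \<open>lexL\<close> takes its default value 0, which
        \<open>l (Suc k) \<ge> 1\<close> excludes.\<close>
      then have "lexL N \<sigma> (Suc k) = 0" by (simp add: lexL_def)
      moreover have "1 \<le> l (Suc k)" using k l by simp
      ultimately show ?thesis unfolding split upt using True by simp
    next
      case False
      have "(LEAST x. x \<in> ?A) = Min {x. x \<in> ?A}"
        by (rule Least_Min) (use False in auto)
      then have "Min ?A = (LEAST x. x \<in> ?A)" by (simp only: Collect_mem_eq)
      then have *: "cyc \<sigma> (LEAST x. x \<in> ?A) = orbit \<sigma> (Min ?A)"
        by (simp add: cyc_eq_orbit[OF _ \<sigma>])
      have "lexL N \<sigma> (Suc k) = card (orbit \<sigma> (Min ?A))"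
        using False * by (simp add: lexL_def)
      moreover have "{1..N} - lex_cycles N \<sigma> (Suc k) = ?A - orbit \<sigma> (Min ?A)"
        using False * by auto
      moreover have "(\<forall>j\<in>{Suc (Suc k)..m}. lexL N \<sigma> j = l j) \<longleftrightarrow>
        lex_lengths ({1..N} - lex_cycles N \<sigma> (Suc k)) \<sigma> (map l [Suc (Suc k)..<Suc m])"
        using Suc k by (intro Suc.hyps) auto
      ultimately show ?thesis unfolding split upt using False by simp
    qed
  qed
  from this[of 0] show ?thesis by simp
qed

section \<open>Splitting off one cycle of a permutation\<close>

lemma orbit_comp:
  assumes "B \<subseteq> A" "\<tau> permutes B" "\<rho> permutes (A - B)"
  shows "y \<in> B \<Longrightarrow> orbit (\<tau> \<circ> \<rho>) y = orbit \<tau> y"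
    and "y \<in> A - B \<Longrightarrow> orbit (\<tau> \<circ> \<rho>) y = orbit \<rho> y"
proof -
  have 1: "(\<tau> \<circ> \<rho>) z = \<tau> z" if "z \<in> B" for z
    using that assms by (simp add: permutes_not_in)
  have 2: "(\<tau> \<circ> \<rho>) z = \<rho> z" if "z \<in> A - B" for z
    using permutes_in_image[OF assms(3), of z] that assms(2) by (simp add: permutes_not_in)
  have 3: "\<tau> z \<in> B" if "z \<in> B" for z using that assms by (simp add: permutes_in_image)
  have 4: "\<rho> z \<in> A - B" if "z \<in> A - B" for z
    using that permutes_in_image[OF assms(3)] by blast
  show "orbit (\<tau> \<circ> \<rho>) y = orbit \<tau> y" if "y \<in> B"
    by (rule orbit_cong0[of _ B]) (use that 1 3 in auto)
  show "orbit (\<tau> \<circ> \<rho>) y = orbit \<rho> y" if "y \<in> A - B"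
    by (rule orbit_cong0[of _ "A - B"]) (use that 2 4 in auto)
qed

text \<open>A permutation whose cycle through \<open>x\<close> has support \<open>B\<close> is
  determined by its restrictions to \<open>B\<close> and to the complement, which give the inverse
  map. The lexicographic condition concerns only the complement.\<close>

lemma bij_betw_cycle_decomp:
  assumes A: "finite A" "B \<subseteq> A" "x \<in> B"
  shows "bij_betw (\<lambda>(\<tau>, \<rho>). \<tau> \<circ> \<rho>)
    ({\<tau>. \<tau> permutes B \<and> orbit \<tau> x = B} \<times> {\<rho>. \<rho> permutes (A - B) \<and> lex_lengths (A - B) \<rho> ls})
    {\<sigma>. \<sigma> permutes A \<and> orbit \<sigma> x = B \<and> lex_lengths (A - B) \<sigma> ls}"
proof (rule bij_betw_byWitness[where f' = "\<lambda>\<sigma>. (perm_restrict \<sigma> B, perm_restrict \<sigma> (A - B))"])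
  have fin: "finite B" "finite (A - B)" using A finite_subset by auto
  have lex: "lex_lengths (A - B) (\<tau> \<circ> \<rho>) ls \<longleftrightarrow> lex_lengths (A - B) \<rho> ls"
    if "\<tau> permutes B" "\<rho> permutes (A - B)" for \<tau> \<rho>
    using that A by (intro lex_lengths_cong orbit_comp(2)) auto
  have cyclic: "cyclic_on \<sigma> B" if "\<sigma> permutes A" "orbit \<sigma> x = B" for \<sigma>
    using cyclic_on_orbit[OF that(1) A(1), of x] that(2) by simp
  have rest: "perm_restrict \<sigma> B permutes B" "perm_restrict \<sigma> (A - B) permutes (A - B)"
    "perm_restrict \<sigma> B \<circ> perm_restrict \<sigma> (A - B) = \<sigma>"
    if "\<sigma> permutes A" "orbit \<sigma> x = B" for \<sigma>
  proof -
    note c = cyclic[OF that]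
    show 2: "perm_restrict \<sigma> (A - B) permutes (A - B)"
      using perm_restrict_diff_cyclic[OF that(1) c] .
    have "\<sigma> ` B = B"
    proof
      show "\<sigma> ` B \<subseteq> B" using cyclic_on_inI[OF c] by auto
      show "B \<subseteq> \<sigma> ` B"
        using endo_inj_surj[of B \<sigma>] \<open>\<sigma> ` B \<subseteq> B\<close> fin that(1) by (metis order_refl permutes_inj_on)
    qed
    then have "bij_betw \<sigma> B B" using that(1) by (simp add: bij_betw_def permutes_inj_on)
    then have "bij_betw (perm_restrict \<sigma> B) B B"
      by (subst bij_betw_cong[of _ _ \<sigma>]) (auto simp: perm_restrict_simps)
    then show 1: "perm_restrict \<sigma> B permutes B"
      by (rule bij_imp_permutes) (auto simp: perm_restrict_simps)
    have "B \<union> (A - B) = A" using A by auto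
    then show "perm_restrict \<sigma> B \<circ> perm_restrict \<sigma> (A - B) = \<sigma>"
      using perm_restrict_union[OF 1 2] that(1) by auto
  qed
  let ?f = "\<lambda>(\<tau>, \<rho>). \<tau> \<circ> \<rho>"
  let ?D = "{\<tau>. \<tau> permutes B \<and> orbit \<tau> x = B} \<times> {\<rho>. \<rho> permutes (A - B) \<and> lex_lengths (A - B) \<rho> ls}"
  let ?E = "{\<sigma>. \<sigma> permutes A \<and> orbit \<sigma> x = B \<and> lex_lengths (A - B) \<sigma> ls}"
  have "(perm_restrict (?f (\<tau>, \<rho>)) B, perm_restrict (?f (\<tau>, \<rho>)) (A - B)) = (\<tau>, \<rho>)"
    if *: "\<tau> permutes B" "\<rho> permutes (A - B)" for \<tau> \<rho>
  proof -
        have "(\<tau> \<circ> \<rho>) y = \<tau> y" if "y \<in> B" for y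
      using that * by (simp add: permutes_not_in)
    then have 1: "perm_restrict (\<tau> \<circ> \<rho>) B = \<tau>"
      using * by (auto simp: fun_eq_iff perm_restrict_def permutes_not_in)
    have "(\<tau> \<circ> \<rho>) y = \<rho> y" if "y \<in> A - B" for y
      using permutes_in_image[OF *(2), of y] that *(1) by (simp add: permutes_not_in)
    then have 2: "perm_restrict (\<tau> \<circ> \<rho>) (A - B) = \<rho>"
      using * by (auto simp: fun_eq_iff perm_restrict_def permutes_not_in)
    show ?thesis using 1 2 by simp
  qed
  then show "\<forall>p\<in>?D. (perm_restrict (?f p) B, perm_restrict (?f p) (A - B)) = p"
    by auto
  show "\<forall>\<sigma>\<in>?E. ?f (perm_restrict \<sigma> B, perm_restrict \<sigma> (A - B)) = \<sigma>"
    using rest by auto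
  have "\<tau> \<circ> \<rho> \<in> ?E"
    if *: "\<tau> permutes B" "orbit \<tau> x = B" "\<rho> permutes (A - B)" "lex_lengths (A - B) \<rho> ls" for \<tau> \<rho>
  proof -
    have "\<tau> permutes A" "\<rho> permutes A"
      using * A by (auto intro: permutes_subset)
    then have "\<tau> \<circ> \<rho> permutes A" by (intro permutes_compose)
    moreover have "orbit (\<tau> \<circ> \<rho>) x = B"
      using orbit_comp(1)[OF A(2) *(1,3), of x] *(2) A by simp
    ultimately show ?thesis
      using lex[OF *(1,3)] *(4) by simp
  qed
  then show "?f ` ?D \<subseteq> ?E" by auto
  have "(perm_restrict \<sigma> B, perm_restrict \<sigma> (A - B)) \<in> ?D"
    if *: "\<sigma> permutes A" "orbit \<sigma> x = B" "lex_lengths (A - B) \<sigma> ls" for \<sigma>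
  proof -
    note r = rest[OF *(1,2)]
    have "orbit (perm_restrict \<sigma> B) x = B"
      using orbit_comp(1)[OF A(2) r(1,2), of x] r(3) A * by simp
    moreover have "lex_lengths (A - B) (perm_restrict \<sigma> (A - B)) ls"
      using lex[OF r(1,2)] r(3) * by simp
    ultimately show ?thesis using r by simp
  qed
  then show "(\<lambda>\<sigma>. (perm_restrict \<sigma> B, perm_restrict \<sigma> (A - B))) ` ?E \<subseteq> ?D" by auto
qed

text \<open>\<open>\<tau>\<close> is a single cycle, so the cycles of the composition are
  \<open>B\<close> and those of \<open>\<rho>\<close>.\<close>

lemma perm_weight_comp:
  assumes "finite A" "B \<subseteq> A" "x \<in> B" "\<tau> permutes B" "orbit \<tau> x = B" "\<rho> permutes (A - B)"
  shows "perm_weight a A (\<tau> \<circ> \<rho>) = a (card B) * perm_weight a (A - B) \<rho>"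
proof -
  have fin: "finite B" "finite (A - B)" using assms finite_subset by auto
  have c: "cyclic_on \<tau> B" using cyclic_on_orbit[OF assms(4) fin(1), of x] assms(5) by simp
  have "orbit (\<tau> \<circ> \<rho>) ` B = {B}"
    using orbit_comp(1)[OF assms(2,4,6)] orbit_cyclic_eq3[OF c] assms(3) by auto
  moreover have "orbit (\<tau> \<circ> \<rho>) ` (A - B) = orbit \<rho> ` (A - B)"
    using orbit_comp(2)[OF assms(2,4,6)] by auto
  moreover have "A = B \<union> (A - B)" using assms by auto
  ultimately have "orbit (\<tau> \<circ> \<rho>) ` A = insert B (orbit \<rho> ` (A - B))"
    by (metis image_Un insert_is_Un)
  moreover have "B \<notin> orbit \<rho> ` (A - B)"
    using orbit_permutes[OF fin(2) assms(6)] by blast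
  ultimately show ?thesis
    unfolding perm_weight_def using fin by simp
qed

section \<open>Summing weights by the length of one cycle\<close>

definition lex_sum :: "(nat \<Rightarrow> real) \<Rightarrow> nat set \<Rightarrow> nat list \<Rightarrow> real" where
  "lex_sum a A ls = (\<Sum>\<sigma> | \<sigma> permutes A \<and> lex_lengths A \<sigma> ls. perm_weight a A \<sigma>)"

text \<open>The number of cyclic permutations of \<open>B\<close> stays a cardinality here, because
  its value is derived from this identity later on.\<close>

lemma sum_perm_weight_cycle:
  assumes "finite A" "B \<subseteq> A" "x \<in> B"
  shows "(\<Sum>\<sigma> | \<sigma> permutes A \<and> orbit \<sigma> x = B \<and> lex_lengths (A - B) \<sigma> ls. perm_weight a A \<sigma>)
    = real (card {\<tau>. \<tau> permutes B \<and> orbit \<tau> x = B}) * a (card B) * lex_sum a (A - B) ls"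
proof -
  let ?T = "{\<tau>. \<tau> permutes B \<and> orbit \<tau> x = B}"
  let ?S = "{\<rho>. \<rho> permutes (A - B) \<and> lex_lengths (A - B) \<rho> ls}"
  have "(\<Sum>\<sigma> | \<sigma> permutes A \<and> orbit \<sigma> x = B \<and> lex_lengths (A - B) \<sigma> ls. perm_weight a A \<sigma>)
    = (\<Sum>(\<tau>, \<rho>)\<in>?T \<times> ?S. perm_weight a A (\<tau> \<circ> \<rho>))"
    using sum.reindex_bij_betw[OF bij_betw_cycle_decomp[OF assms], of "perm_weight a A" ls, symmetric]
    by (simp add: case_prod_unfold)
  also have "\<dots> = (\<Sum>(\<tau>, \<rho>)\<in>?T \<times> ?S. a (card B) * perm_weight a (A - B) \<rho>)"
    by (rule sum.cong) (use perm_weight_comp[OF assms] in auto)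
  also have "\<dots> = real (card ?T) * a (card B) * lex_sum a (A - B) ls"
    by (simp add: sum.cartesian_product[symmetric] lex_sum_def sum_distrib_left mult_ac)
  finally show ?thesis .
qed

lemma card_subsets_containing:
  assumes "finite A" "x \<in> A" "1 \<le> l"
  shows "card {B. B \<subseteq> A \<and> x \<in> B \<and> card B = l} = (card A - 1) choose (l - 1)"
proof -
  have "bij_betw (insert x) {C. C \<subseteq> A - {x} \<and> card C = l - 1} {B. B \<subseteq> A \<and> x \<in> B \<and> card B = l}"
  proof (rule bij_betw_byWitness[where f' = "\<lambda>B. B - {x}"])
    show "insert x ` {C. C \<subseteq> A - {x} \<and> card C = l - 1} \<subseteq> {B. B \<subseteq> A \<and> x \<in> B \<and> card B = l}"
    proof safe
      fix C assume "C \<subseteq> A - {x}" "card C = l - 1"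
      then show "card (insert x C) = l"
        using assms finite_subset[of C A] by (subst card_insert_disjoint) auto
    qed (use assms in auto)
    show "(\<lambda>B. B - {x}) ` {B. B \<subseteq> A \<and> x \<in> B \<and> card B = l} \<subseteq> {C. C \<subseteq> A - {x} \<and> card C = l - 1}"
      using assms finite_subset by auto
  qed auto
  then have "card {B. B \<subseteq> A \<and> x \<in> B \<and> card B = l} = card {C. C \<subseteq> A - {x} \<and> card C = l - 1}"
    by (rule bij_betw_same_card[symmetric])
  also have "\<dots> = card (A - {x}) choose (l - 1)" using assms by (intro n_subsets) auto
  finally show ?thesis using assms by simp
qed

text \<open>Permutations are grouped by the support \<open>B\<close> of the cycle through
  \<open>x\<close>. With \<open>c\<close> and \<open>v\<close> as parameters the identity serves
  both for counting cyclic permutations and for evaluating \<open>lex_sum\<close>.\<close>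

lemma sum_perm_weight_length:
  assumes A: "finite A" "x \<in> A" and l: "1 \<le> l"
    and c: "\<And>B. B \<subseteq> A \<Longrightarrow> x \<in> B \<Longrightarrow> card B = l \<Longrightarrow> card {\<tau>. \<tau> permutes B \<and> orbit \<tau> x = B} = c"
    and v: "\<And>B. B \<subseteq> A \<Longrightarrow> x \<in> B \<Longrightarrow> card B = l \<Longrightarrow> lex_sum a (A - B) ls = v"
  shows "(\<Sum>\<sigma> | \<sigma> permutes A \<and> card (orbit \<sigma> x) = l \<and> lex_lengths (A - orbit \<sigma> x) \<sigma> ls. perm_weight a A \<sigma>)
    = real ((card A - 1) choose (l - 1)) * real c * a l * v"
proof -
  let ?S = "{\<sigma>. \<sigma> permutes A \<and> card (orbit \<sigma> x) = l \<and> lex_lengths (A - orbit \<sigma> x) \<sigma> ls}"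
  let ?T = "{B. B \<subseteq> A \<and> x \<in> B \<and> card B = l}"
  have "sum (perm_weight a A) ?S = (\<Sum>B\<in>?T. \<Sum>\<sigma>\<in>{\<sigma>\<in>?S. orbit \<sigma> x = B}. perm_weight a A \<sigma>)"
  proof (rule sum.group[symmetric])
    show "finite ?S" using finite_permutations[OF A(1)] by (rule rev_finite_subset) auto
    show "finite ?T" using A by simp
    show "(\<lambda>\<sigma>. orbit \<sigma> x) ` ?S \<subseteq> ?T"
      using orbit_permutes[OF A(1) _ A(2)] by auto
  qed
  also have "\<dots> = (\<Sum>B\<in>?T. real c * a l * v)"
  proof (rule sum.cong)
    fix B assume B: "B \<in> ?T"
    then have "{\<sigma>\<in>?S. orbit \<sigma> x = B} = {\<sigma>. \<sigma> permutes A \<and> orbit \<sigma> x = B \<and> lex_lengths (A - B) \<sigma> ls}"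
      by auto
    then show "(\<Sum>\<sigma>\<in>{\<sigma>\<in>?S. orbit \<sigma> x = B}. perm_weight a A \<sigma>) = real c * a l * v"
      using sum_perm_weight_cycle[of A B x a ls] A B c v by simp
  qed simp
  also have "\<dots> = real (card ?T) * (real c * a l * v)" by simp
  finally show ?thesis using card_subsets_containing[OF A l] by simp
qed

lemma sum_perm_weight_split:
  assumes A: "finite A" "x \<in> A"
  shows "lex_sum a A [] = (\<Sum>l=1..card A. \<Sum>\<sigma> | \<sigma> permutes A \<and> card (orbit \<sigma> x) = l. perm_weight a A \<sigma>)"
proof -
  have "card (orbit \<sigma> x) \<in> {1..card A}" if "\<sigma> permutes A" for \<sigma>
    using orbit_permutes[OF A(1) that A(2)] A by (auto simp: Suc_le_eq card_gt_0_iff intro!: card_mono)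
  then have "lex_sum a A [] = (\<Sum>l=1..card A. \<Sum>\<sigma>\<in>{\<sigma>\<in>{\<sigma>. \<sigma> permutes A}. card (orbit \<sigma> x) = l}. perm_weight a A \<sigma>)"
    unfolding lex_sum_def using A
    by (subst sum.group) (auto simp: finite_permutations)
  then show ?thesis by simp
qed

lemma binomial_cycle_fact:
  assumes "1 \<le> l" "l \<le> n"
  shows "real ((n - 1) choose (l - 1)) * fact (l - 1) * fact (n - l) = fact (n - 1)"
proof -
  have "n - 1 - (l - 1) = n - l" using assms by simp
  then have "fact (l - 1) * fact (n - l) * ((n - 1) choose (l - 1)) = fact (n - 1)"
    using binomial_fact_lemma[of "l - 1" "n - 1"] assms by simp
  then have "real (fact (l - 1) * fact (n - l) * ((n - 1) choose (l - 1))) = real (fact (n - 1))"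
    by (rule arg_cong)
  then show ?thesis by (simp add: mult_ac)
qed

text \<open>Classify the \<open>n!\<close> permutations by the length of the cycle through
  \<open>x\<close>. By strong induction each length below \<open>n\<close> accounts for
  \<open>(n-1)!\<close> of them, which leaves \<open>n! - (n-1) (n-1)! = (n-1)!\<close> full
  cycles.\<close>

lemma card_cyclic_permutations:
  fixes A :: "nat set"
  assumes "finite A" "x \<in> A"
  shows "card {\<tau>. \<tau> permutes A \<and> orbit \<tau> x = A} = fact (card A - 1)"
  using assms
proof (induction "card A" arbitrary: A rule: less_induct)
  case less
  let ?n = "card A" and ?c = "\<lambda>B. card {\<tau>. \<tau> permutes B \<and> orbit \<tau> x = B}"
  have n: "1 \<le> ?n" using less.prems by (auto simp: Suc_le_eq card_gt_0_iff)
  have one: "lex_sum (\<lambda>_. 1) B [] = fact (card B)" if "finite B" for B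
    using that by (simp add: lex_sum_def perm_weight_def card_permutations)
  have "fact ?n = (\<Sum>l=1..?n. \<Sum>\<sigma> | \<sigma> permutes A \<and> card (orbit \<sigma> x) = l. perm_weight (\<lambda>_. 1) A \<sigma>)"
    using sum_perm_weight_split[OF less.prems, of "\<lambda>_. 1"] one less.prems by simp
  also have "\<dots> = (\<Sum>l=1..?n. real ((?n - 1) choose (l - 1)) * real (if l = ?n then ?c A else fact (l - 1)) * fact (?n - l))"
  proof (rule sum.cong)
    fix l assume l: "l \<in> {1..?n}"
    \<comment> \<open>For \<open>l = ?n\<close> the only admissible \<open>B\<close> is
      \<open>A\<close>, whose count is the unknown; smaller supports fall under the induction
      hypothesis.\<close>
    have "?c B = (if l = ?n then ?c A else fact (l - 1))"
      if "B \<subseteq> A" "x \<in> B" "card B = l" for B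
    proof (cases "l = ?n")
      case True
      then have "B = A" using that less.prems by (intro card_subset_eq) auto
      then show ?thesis using True by simp
    next
      case False
      then have "card B < card A" using that l by auto
      then show ?thesis
        using less.hyps[of B] that False finite_subset[OF that(1) less.prems(1)] by simp
    qed
    moreover have "lex_sum (\<lambda>_. 1) (A - B) [] = fact (?n - l)"
      if "B \<subseteq> A" "x \<in> B" "card B = l" for B
    proof -
      have "card (A - B) = ?n - l"
        using that finite_subset[OF that(1) less.prems(1)] by (simp add: card_Diff_subset)
      then show ?thesis using one[of "A - B"] less.prems by simp
    qed
    ultimately show "(\<Sum>\<sigma> | \<sigma> permutes A \<and> card (orbit \<sigma> x) = l. perm_weight (\<lambda>_. 1) A \<sigma>)
       = real ((?n - 1) choose (l - 1)) * real (if l = ?n then ?c A else fact (l - 1)) * fact (?n - l)"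
      using sum_perm_weight_length[of A x l "if l = ?n then ?c A else fact (l - 1)" "\<lambda>_. 1" "[]"] less.prems l
      by simp
  qed simp
  also have "\<dots> = (\<Sum>l\<in>{1..<?n}. fact (?n - 1)) + real (?c A)"
  proof -
    have "{1..?n} = insert ?n {1..<?n}" using n by auto
    moreover have "(\<Sum>l\<in>{1..<?n}. real ((?n - 1) choose (l - 1)) * real (if l = ?n then ?c A else fact (l - 1)) * fact (?n - l))
       = (\<Sum>l\<in>{1..<?n}. fact (?n - 1))"
    proof (rule sum.cong)
      fix l assume "l \<in> {1..<?n}"
      then show "real ((?n - 1) choose (l - 1)) * real (if l = ?n then ?c A else fact (l - 1)) * fact (?n - l)
        = fact (?n - 1)"
        using binomial_cycle_fact[of l ?n] by simp
    qed simp
    ultimately show ?thesis by simp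
  qed
  also have "\<dots> = real (?n - 1) * fact (?n - 1) + real (?c A)" by simp
  finally have "real (?c A) = fact ?n - real (?n - 1) * fact (?n - 1)" by simp
  also have "fact ?n = real ?n * fact (?n - 1)" using n by (intro fact_reduce) auto
  finally have "real (?c A) = (real ?n - real (?n - 1)) * fact (?n - 1)" by (simp add: algebra_simps)
  also have "real ?n - real (?n - 1) = 1" using n by (simp add: of_nat_diff)
  finally have "real (?c A) = real (fact (?n - 1))" by simp
  then show ?case by (simp only: of_nat_eq_iff)
qed

text \<open>The sum of weights over permutations of \<open>n\<close> points with prescribed first
  cycle lengths, divided by \<open>n!\<close>.\<close>

fun lex_gf :: "(nat \<Rightarrow> real) \<Rightarrow> nat \<Rightarrow> nat list \<Rightarrow> real" where
  "lex_gf a n [] = cyc_gf a n"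
| "lex_gf a n (l # ls) = (if 1 \<le> l \<and> l \<le> n then a l / real n * lex_gf a (n - l) ls else 0)"

text \<open>Classifying by the cycle through one point gives the recursion of \<open>cyc_gf\<close>:
  the choices of support, the cyclic arrangements and the factorial of the rest multiply to
  \<open>(n-1)!\<close> for every length.\<close>

lemma lex_sum_Nil: "finite A \<Longrightarrow> lex_sum a A [] = fact (card A) * cyc_gf a (card A)"
proof (induction "card A" arbitrary: A rule: less_induct)
  case less
  let ?n = "card A"
  show ?case
  proof (cases "A = {}")
    case True
    then show ?thesis by (simp add: lex_sum_def perm_weight_def)
  next
    case False
    then obtain x where x: "x \<in> A" by auto
    have n: "1 \<le> ?n" using less.prems False by (auto simp: Suc_le_eq card_gt_0_iff)
    have "lex_sum a A [] = (\<Sum>l=1..?n. \<Sum>\<sigma> | \<sigma> permutes A \<and> card (orbit \<sigma> x) = l. perm_weight a A \<sigma>)"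
      by (rule sum_perm_weight_split) (use less.prems x in auto)
    also have "\<dots> = (\<Sum>l=1..?n. fact (?n - 1) * (a l * cyc_gf a (?n - l)))"
    proof (rule sum.cong)
      fix l assume l: "l \<in> {1..?n}"
      have c: "card {\<tau>. \<tau> permutes B \<and> orbit \<tau> x = B} = fact (l - 1)"
        if "B \<subseteq> A" "x \<in> B" "card B = l" for B
        using card_cyclic_permutations[of B x] that less.prems finite_subset by auto
      have v: "lex_sum a (A - B) [] = fact (?n - l) * cyc_gf a (?n - l)"
        if "B \<subseteq> A" "x \<in> B" "card B = l" for B
      proof -
        have "card (A - B) = ?n - l"
          using that less.prems by (auto simp: card_Diff_subset finite_subset)
        then show ?thesis using less.hyps[of "A - B"] less.prems l by auto
      qed
      show "(\<Sum>\<sigma> | \<sigma> permutes A \<and> card (orbit \<sigma> x) = l. perm_weight a A \<sigma>)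
         = fact (?n - 1) * (a l * cyc_gf a (?n - l))"
        using sum_perm_weight_length[OF less.prems x _ c v] l binomial_cycle_fact[of l ?n, symmetric]
        by (simp add: mult_ac)
    qed simp
    also have "\<dots> = fact (?n - 1) * (real ?n * cyc_gf a ?n)"
      by (simp add: cyc_gf_rec sum_distrib_left)
    also have "\<dots> = fact ?n * cyc_gf a ?n"
      using n by (simp add: fact_reduce[of ?n])
    finally show ?thesis .
  qed
qed

text \<open>The same count with \<open>x\<close> the minimum, whose cycle comes first in the
  lexicographic order; the induction removes this cycle.\<close>

lemma lex_sum_eq_lex_gf:
  "finite A \<Longrightarrow> lex_sum a A ls = fact (card A) * lex_gf a (card A) ls"
proof (induction ls arbitrary: A)
  case Nil
  then show ?case by (simp add: lex_sum_Nil)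
next
  case (Cons l ls)
  let ?n = "card A"
  show ?case
  proof (cases "A = {}")
    case True
    then show ?thesis by (simp add: lex_sum_def)
  next
    case False
    define x where "x = Min A"
    have x: "x \<in> A" using False Cons.prems by (simp add: x_def)
    have set: "{\<sigma>. \<sigma> permutes A \<and> lex_lengths A \<sigma> (l # ls)}
       = {\<sigma>. \<sigma> permutes A \<and> card (orbit \<sigma> x) = l \<and> lex_lengths (A - orbit \<sigma> x) \<sigma> ls}"
      using False by (auto simp: x_def)
    show ?thesis
    proof (cases "1 \<le> l \<and> l \<le> ?n")
      case True
      have c: "card {\<tau>. \<tau> permutes B \<and> orbit \<tau> x = B} = fact (l - 1)"
        if "B \<subseteq> A" "x \<in> B" "card B = l" for B
        using card_cyclic_permutations[of B x] that Cons.prems finite_subset by auto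
      have v: "lex_sum a (A - B) ls = fact (?n - l) * lex_gf a (?n - l) ls"
        if "B \<subseteq> A" "x \<in> B" "card B = l" for B
      proof -
        have "card (A - B) = ?n - l"
          using that Cons.prems by (auto simp: card_Diff_subset finite_subset)
        then show ?thesis using Cons by auto
      qed
      have "lex_sum a A (l # ls) = fact (?n - 1) * (a l * lex_gf a (?n - l) ls)"
        unfolding lex_sum_def set
        using sum_perm_weight_length[OF Cons.prems x _ c v] True binomial_cycle_fact[of l ?n, symmetric]
        by (simp add: mult_ac)
      moreover have "fact ?n = real ?n * fact (?n - 1)" using True by (intro fact_reduce) auto
      ultimately show ?thesis using True by simp
    next
      case False
      have "card (orbit \<sigma> x) \<in> {1..card A}" if "\<sigma> permutes A" for \<sigma>
        using orbit_permutes[OF Cons.prems that x] Cons.prems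
        by (auto simp: Suc_le_eq card_gt_0_iff intro!: card_mono)
      then have "{\<sigma>. \<sigma> permutes A \<and> lex_lengths A \<sigma> (l # ls)} = {}"
        unfolding set using False by auto
      then have "lex_sum a A (l # ls) = 0" unfolding lex_sum_def by (simp only: sum.empty)
      then show ?thesis using False by auto
    qed
  qed
qed

lemma PN_lexL:
  fixes \<theta> \<kappa> :: "nat \<Rightarrow> real"
  defines "a \<equiv> \<lambda>N j. \<theta> j + real N * \<kappa> j"
  assumes l: "\<And>j. 1 \<le> j \<Longrightarrow> j \<le> m \<Longrightarrow> 1 \<le> l j"
  shows "PN \<theta> \<kappa> N (\<lambda>\<sigma>. \<forall>j\<in>{1..m}. lexL N \<sigma> j = l j)
    = lex_gf (a N) N (map l [1..<Suc m]) / cyc_gf (a N) N"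
proof -
  have w: "weight \<theta> \<kappa> N \<sigma> = perm_weight (a N) {1..N} \<sigma>" if "\<sigma> permutes {1..N}" for \<sigma>
    using weight_eq_perm_weight[OF that] by (simp add: a_def)
  have "H \<theta> \<kappa> N = lex_sum (a N) {1..N} [] / fact N"
    unfolding H_def lex_sum_def by (simp add: w)
  then have H: "H \<theta> \<kappa> N = cyc_gf (a N) N" by (simp add: lex_sum_eq_lex_gf)
  have "PN \<theta> \<kappa> N (\<lambda>\<sigma>. \<forall>j\<in>{1..m}. lexL N \<sigma> j = l j)
     = lex_sum (a N) {1..N} (map l [1..<Suc m]) / (fact N * H \<theta> \<kappa> N)"
    unfolding PN_def lex_sum_def sum_divide_distrib
    by (intro sum.cong Collect_cong conj_cong refl lexL_iff_lex_lengths l) (auto simp: w)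
  then show ?thesis by (simp add: H lex_sum_eq_lex_gf del: upt_Suc)
qed

section \<open>Growth of the coefficients\<close>

lemma ln_le_iff_le_exp: "0 < x \<Longrightarrow> ln x \<le> y \<longleftrightarrow> x \<le> exp y" for x y :: real
  by (metis exp_gt_zero ln_exp ln_le_cancel_iff)

section \<open>Supermultiplicativity and growth along the diagonal\<close>

lemma cyc_gf_power_le:
  assumes \<kappa>: "\<And>j. 0 \<le> \<kappa> j"
  shows "cyc_gf (\<lambda>j. real k * \<kappa> j) n ^ c \<le> cyc_gf (\<lambda>j. real (c * k) * \<kappa> j) (c * n)"
proof (induction c)
  case (Suc c)
  have "cyc_gf (\<lambda>j. real k * \<kappa> j) n ^ Suc c
      \<le> cyc_gf (\<lambda>j. real k * \<kappa> j) n * cyc_gf (\<lambda>j. real (c * k) * \<kappa> j) (c * n)"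
    using Suc by (simp add: mult_left_mono cyc_gf_nonneg \<kappa>)
  also have "\<dots> \<le> cyc_gf (\<lambda>j. real k * \<kappa> j + real (c * k) * \<kappa> j) (n + c * n)"
    by (rule cyc_gf_supermult) (auto simp: \<kappa>)
  also have "(\<lambda>j. real k * \<kappa> j + real (c * k) * \<kappa> j) = (\<lambda>j. real (Suc c * k) * \<kappa> j)"
    by (auto simp: algebra_simps)
  finally show ?case by simp
qed simp

lemma cyc_gf_scale_supermult:
  assumes \<kappa>: "\<And>j. 0 \<le> \<kappa> j"
  shows "cyc_gf (\<lambda>j. real k * \<kappa> j) n * cyc_gf (\<lambda>j. real k' * \<kappa> j) n'
    \<le> cyc_gf (\<lambda>j. real (k + k') * \<kappa> j) (n + n')"
proof -
  have "(\<lambda>j. real (k + k') * \<kappa> j) = (\<lambda>j. real k * \<kappa> j + real k' * \<kappa> j)"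
    by (auto simp: algebra_simps)
  then show ?thesis
    using cyc_gf_supermult[of "\<lambda>j. real k * \<kappa> j" "\<lambda>j. real k' * \<kappa> j" n n'] \<kappa> by simp
qed

lemma cyc_gf_ge_term:
  assumes "\<And>j. 0 \<le> a j" "1 \<le> j" "j \<le> n"
  shows "a j * cyc_gf a (n - j) \<le> real n * cyc_gf a n"
  unfolding cyc_gf_rec
  by (rule member_le_sum) (use assms in \<open>auto intro!: mult_nonneg_nonneg cyc_gf_nonneg\<close>)

text \<open>The function \<open>(k, n) \<mapsto> ln (cyc_gf (k \<kappa>) n)\<close> is superadditive, and \<open>L\<close> bounds its
  slope on the diagonal; \<open>ln \<rho>\<close> is minus the slope in direction \<open>n\<close> of a supporting line there.\<close>
lemma cyc_gf_supporting_line: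
  assumes \<kappa>: "\<And>j. 0 \<le> \<kappa> j" and pos: "j \<ge> 2" "\<kappa> j > 0"
    and L: "\<And>K. cyc_gf (\<lambda>j. real K * \<kappa> j) K \<le> exp (real K * L)"
  obtains \<rho> where "\<rho> > 0"
    "\<And>k n. k \<ge> 1 \<Longrightarrow> cyc_gf (\<lambda>j. real k * \<kappa> j) n * \<rho> ^ n \<le> (exp L * \<rho>) ^ k"
proof -
  define h where "h = (\<lambda>k n. cyc_gf (\<lambda>j. real k * \<kappa> j) n)"
  define D where "D = (\<lambda>k n. ln (h k n) - L * real k)"
  \<comment> \<open>\<open>c = k' - n'\<close> copies of a point above the diagonal
    \<open>n = k\<close> and \<open>d = n - k\<close> copies of one below it add up to a point on
    the diagonal, where \<open>L\<close> is a bound.\<close>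
  have cross: "real (k' - n') * D k n + real (n - k) * D k' n' \<le> 0"
    if "h k n > 0" "k < n" "h k' n' > 0" "n' < k'" for k n k' n'
  proof -
    define c d where "c = k' - n'" and "d = n - k"
    have nk: "n = k + d" "k' = n' + c" using that by (auto simp: c_def d_def)
    have eq: "c * n + d * n' = c * k + d * k'" by (simp add: nk algebra_simps)
    have "h k n ^ c * h k' n' ^ d \<le> h (c * k) (c * n) * h (d * k') (d * n')"
      unfolding h_def by (intro mult_mono cyc_gf_power_le \<kappa> zero_le_power cyc_gf_nonneg) (auto simp: \<kappa>)
    also have "\<dots> \<le> h (c * k + d * k') (c * n + d * n')"
      unfolding h_def by (rule cyc_gf_scale_supermult[OF \<kappa>])
    also have "\<dots> \<le> exp (real (c * k + d * k') * L)"
      unfolding h_def eq by (rule L)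
    finally have "ln (h k n ^ c * h k' n' ^ d) \<le> real (c * k + d * k') * L"
      using that by (subst ln_le_iff_le_exp) auto
    then have "real c * ln (h k n) + real d * ln (h k' n') \<le> real (c * k + d * k') * L"
      using that by (simp add: ln_mult ln_realpow)
    then show ?thesis
      by (simp add: D_def c_def[symmetric] d_def[symmetric] algebra_simps)
  qed
  \<comment> \<open>Slopes of the excess \<open>D\<close> at points above the diagonal. Points below
    bound them from above, and the supremum serves as the slope \<open>s\<close>.\<close>
  define S where "S = {D k n / real (n - k) | k n. h k n > 0 \<and> k < n}"
  have le: "x \<le> - D k' n' / real (k' - n')" if "x \<in> S" "h k' n' > 0" "n' < k'" for x k' n'
  proof -
    from that obtain k n where x: "x = D k n / real (n - k)" "h k n > 0" "k < n"
      by (auto simp: S_def)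
    have "real (k' - n') * D k n \<le> (- D k' n') * real (n - k)"
      using cross[OF x(2,3) that(2,3)] by (simp add: algebra_simps)
    then show ?thesis unfolding x using x(3) that(3)
      by (simp add: field_simps del: of_nat_diff)
  qed
  \<comment> \<open>Since \<open>j \<ge> 2\<close>, the point \<open>(1, j)\<close> lies above the
    diagonal and makes \<open>S\<close> nonempty; boundedness comes from \<open>(1, 0)\<close>,
    where \<open>h\<close> is 1.\<close>
  have "\<kappa> j * cyc_gf \<kappa> (j - j) \<le> real j * cyc_gf \<kappa> j"
    by (rule cyc_gf_ge_term) (use \<kappa> pos in auto)
  then have "0 < real j * cyc_gf \<kappa> j" using pos by simp
  then have "h 1 j > 0" by (simp add: h_def zero_less_mult_iff)
  then have "D 1 j / real (j - 1) \<in> S"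
    using pos unfolding S_def by (intro CollectI exI[of _ 1] exI[of _ j]) auto
  then have ne: "S \<noteq> {}" by auto
  have bdd: "bdd_above S"
    by (rule bdd_aboveI[of _ "- D 1 0 / real (1 - 0)"]) (rule le, auto simp: h_def)
  define s where "s = Sup S"
  have ln_h: "ln (h k n) \<le> L * real k + s * (real n - real k)" if "h k n > 0" for k n
  proof (cases n k rule: linorder_cases)
    case less
    have "s \<le> - D k n / real (k - n)"
      unfolding s_def by (rule cSup_least) (use ne le that less in auto)
    then have "s * (real k - real n) \<le> - D k n"
      using less by (simp add: field_simps of_nat_diff)
    then show ?thesis by (simp add: D_def algebra_simps)
  next
    case equal
    then show ?thesis using L[of k] that by (simp add: h_def ln_le_iff_le_exp mult.commute)
  next
    case greater
    have "D k n / real (n - k) \<le> s"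
      unfolding s_def by (rule cSup_upper[OF _ bdd]) (use that greater in \<open>unfold S_def, blast\<close>)
    then have "D k n \<le> s * (real n - real k)"
      using greater by (simp add: field_simps of_nat_diff)
    then show ?thesis by (simp add: D_def algebra_simps)
  qed
  have "h k n * exp (- s) ^ n \<le> (exp L * exp (- s)) ^ k" for k n
  proof (cases "h k n > 0")
    case True
    have "h k n \<le> exp (L * real k + s * (real n - real k))"
      using ln_h[OF True] True by (simp add: ln_le_iff_le_exp)
    then have "h k n * exp (- s) ^ n \<le> exp (L * real k + s * (real n - real k)) * exp (- s) ^ n"
      by (intro mult_right_mono) auto
    also have "\<dots> = (exp L * exp (- s)) ^ k"
      by (simp add: exp_of_nat_mult[symmetric] algebra_simps flip: exp_add)
    finally show ?thesis .
  next
    case False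
    have "0 \<le> h k n" unfolding h_def by (rule cyc_gf_nonneg) (simp add: \<kappa>)
    with False have "h k n = 0" by simp
    then show ?thesis by simp
  qed
  then show ?thesis
    by (intro that[of "exp (- s)"]) (auto simp: h_def)
qed

lemma le_of_linear_bound:
  fixes x y c :: real
  assumes "\<And>k::nat. k \<ge> 1 \<Longrightarrow> real k * x \<le> real k * y + c"
  shows "x \<le> y"
proof (rule ccontr)
  assume "\<not> x \<le> y"
  then have xy: "x - y > 0" by simp
  obtain k :: nat where k: "real k > \<bar>c\<bar> / (x - y)" using reals_Archimedean2 by blast
  then have "real k > 0" using xy by (meson divide_nonneg_pos abs_ge_zero order_le_less_trans)
  then have "k \<ge> 1" by simp
  from assms[OF this] have "real k * (x - y) \<le> c" by (simp add: algebra_simps)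
  moreover have "real k * (x - y) > \<bar>c\<bar>" using k xy by (simp add: field_simps)
  ultimately show False by simp
qed

text \<open>Summing the bound over \<open>n\<close> at some \<open>t < \<rho>\<close> compares
  \<open>exp (k G(t))\<close> with \<open>(e^L \<rho>)^k\<close> times a geometric series. Large
  \<open>k\<close> removes the geometric factor, and then \<open>t\<close> tends to
  \<open>\<rho>\<close>.\<close>

lemma exp_sum_le_of_supporting_line:
  assumes \<kappa>: "\<And>j. 0 \<le> \<kappa> j" and \<rho>: "\<rho> > 0"
    and bd: "\<And>k n. k \<ge> 1 \<Longrightarrow> cyc_gf (\<lambda>j. real k * \<kappa> j) n * \<rho> ^ n \<le> (exp L * \<rho>) ^ k"
  shows "(\<Sum>j=1..M. \<kappa> j * \<rho> ^ j / real j) \<le> L + ln \<rho>"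
proof -
  let ?G = "\<lambda>t. \<Sum>j=1..M. \<kappa> j * t ^ j / real j"
  have t: "?G t \<le> L + ln \<rho>" if t: "0 < t" "t < \<rho>" for t
  proof (rule le_of_linear_bound)
    fix k :: nat assume k: "k \<ge> 1"
    let ?c = "\<lambda>n. cyc_gf (\<lambda>i. if i \<le> M then real k * \<kappa> i else 0) n * t ^ n"
    let ?B = "(exp L * \<rho>) ^ k"
    have q: "0 \<le> t / \<rho>" "t / \<rho> < 1" using t \<rho> by auto
    have s1: "?c sums exp (real k * ?G t)"
    proof -
      have "real k * ?G t = (\<Sum>j=1..M. real k * \<kappa> j * t ^ j / real j)"
        unfolding sum_distrib_left by (intro sum.cong) auto
      then show ?thesis
        using cyc_gf_trunc_sums[of "\<lambda>j. real k * \<kappa> j" t M] t \<kappa> by simp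
    qed
    have s2: "(\<lambda>n. ?B * (t / \<rho>) ^ n) sums (?B * (1 / (1 - t / \<rho>)))"
      using q by (intro sums_mult geometric_sums) auto
    have "?c n \<le> ?B * (t / \<rho>) ^ n" for n
    proof -
      have "?c n \<le> cyc_gf (\<lambda>i. real k * \<kappa> i) n * t ^ n"
        using t \<kappa> by (intro mult_right_mono cyc_gf_mono) auto
      also have "\<dots> = cyc_gf (\<lambda>i. real k * \<kappa> i) n * \<rho> ^ n * (t / \<rho>) ^ n"
        using \<rho> by (simp add: power_divide)
      also have "\<dots> \<le> ?B * (t / \<rho>) ^ n"
        using bd[OF k] q by (intro mult_right_mono) auto
      finally show ?thesis .
    qed
    then have "exp (real k * ?G t) \<le> ?B * (1 / (1 - t / \<rho>))"
      by (rule sums_le[OF _ s1 s2])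
    then have "real k * ?G t \<le> ln (?B * (1 / (1 - t / \<rho>)))"
      using \<rho> q by (subst ln_ge_iff) (simp_all only: mult_pos_pos zero_less_power exp_gt_zero zero_less_divide_1_iff diff_gt_0_iff_gt)
    also have "\<dots> = real k * (L + ln \<rho>) + ln (1 / (1 - t / \<rho>))"
      using \<rho> q by (simp only: ln_mult[of ?B] ln_realpow ln_mult[of "exp L" \<rho>]) (simp add: ln_mult ln_realpow)
    finally show "real k * ?G t \<le> real k * (L + ln \<rho>) + ln (1 / (1 - t / \<rho>))" .
  qed
  have "(?G \<longlongrightarrow> ?G \<rho>) (at_left \<rho>)"
    by (intro tendsto_intros) auto
  moreover have "eventually (\<lambda>t. ?G t \<le> L + ln \<rho>) (at_left \<rho>)"
    using eventually_at_left_real[OF \<rho>] by (rule eventually_mono) (use t in simp)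
  ultimately show ?thesis
    by (rule tendsto_upperbound) auto
qed

text \<open>The convex function \<open>u \<mapsto> e^(j u) / j\<close> lies above its tangent at
  \<open>u = ln r\<close>.\<close>

lemma power_diff_ge_ln:
  assumes "0 < r" "0 < (s::real)" "1 \<le> j"
  shows "r ^ j * ln (s / r) \<le> (s ^ j - r ^ j) / real j"
proof -
  have "1 + real j * ln (s / r) \<le> exp (real j * ln (s / r))" by (rule exp_ge_add_one_self)
  also have "\<dots> = s ^ j / r ^ j"
    using assms by (simp add: exp_of_nat_mult power_divide)
  finally have "r ^ j * (1 + real j * ln (s / r)) \<le> s ^ j"
    using assms by (simp add: field_simps)
  then show ?thesis using assms by (simp add: field_simps)
qed

lemma sum_power_diff_ge_ln:
  assumes "0 < r" "0 < (s::real)" "\<And>j. 0 \<le> \<kappa> j"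
  shows "(\<Sum>j=1..M. \<kappa> j * r ^ j / real j) + ln (s / r) * (\<Sum>j=1..M. \<kappa> j * r ^ j)
    \<le> (\<Sum>j=1..M. \<kappa> j * s ^ j / real j)"
proof -
  have "\<kappa> j * r ^ j / real j + ln (s / r) * (\<kappa> j * r ^ j) \<le> \<kappa> j * s ^ j / real j"
    if "j \<in> {1..M}" for j
  proof -
    have "\<kappa> j * (r ^ j * ln (s / r)) \<le> \<kappa> j * ((s ^ j - r ^ j) / real j)"
      using that assms by (intro mult_left_mono power_diff_ge_ln) auto
    then show ?thesis by (simp add: algebra_simps diff_divide_distrib)
  qed
  then have "(\<Sum>j=1..M. \<kappa> j * r ^ j / real j + ln (s / r) * (\<kappa> j * r ^ j))
      \<le> (\<Sum>j=1..M. \<kappa> j * s ^ j / real j)"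
    by (rule sum_mono)
  then show ?thesis by (simp add: sum.distrib sum_distrib_left)
qed

section \<open>Consequences of the non-arithmetic support\<close>

lemma int_subgroup_UNIV:
  fixes G :: "int set" and \<kappa> :: "nat \<Rightarrow> real"
  assumes diff: "\<And>x y. x \<in> G \<Longrightarrow> y \<in> G \<Longrightarrow> x - y \<in> G"
    and supp: "\<And>j. 1 \<le> j \<Longrightarrow> \<kappa> j \<noteq> 0 \<Longrightarrow> int j \<in> G"
    and pos: "1 \<le> j" "\<kappa> j \<noteq> 0"
    and non_arith: "\<not> (\<exists>j0::nat. j0 > 1 \<and> (\<forall>j\<ge>1. \<kappa> j \<noteq> 0 \<longrightarrow> j0 dvd j))"
  shows "x \<in> G"
proof -
  have zero: "0 \<in> G" using diff[of "int j" "int j"] supp[OF pos] by simp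
  have neg: "- y \<in> G" if "y \<in> G" for y using diff[OF zero that] by simp
  have add: "y + z \<in> G" if "y \<in> G" "z \<in> G" for y z
    using diff[OF that(1) neg[OF that(2)]] by simp
  have nmult: "int n * y \<in> G" if "y \<in> G" for n y
    by (induction n) (use zero add that in \<open>auto simp: algebra_simps\<close>)
  have mult: "k * y \<in> G" if "y \<in> G" for k y
    by (cases k rule: int_cases2) (use nmult neg that in force)+
  \<comment> \<open>The least positive element divides every index in the support, since a nonzero
    remainder would be a smaller positive element; non-arithmeticity then forces it to be 1.\<close>
  define d where "d = (LEAST d::nat. 1 \<le> d \<and> int d \<in> G)"
  have d: "1 \<le> d" "int d \<in> G"
    using LeastI[of "\<lambda>d. 1 \<le> d \<and> int d \<in> G" j] supp[OF pos] pos by (auto simp: d_def)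
  have "d dvd i" if "1 \<le> i" "\<kappa> i \<noteq> 0" for i
  proof (rule ccontr)
    assume "\<not> d dvd i"
    then have "1 \<le> i mod d" by (simp add: mod_greater_zero_iff_not_dvd Suc_leI)
    moreover have "int (i mod d) = int i - int (i div d) * int d"
      by (metis minus_div_mult_eq_mod of_nat_mod of_nat_div of_nat_mult zdiv_int zmod_int)
    then have "int (i mod d) \<in> G" using diff supp[OF that] nmult[OF d(2)] by simp
    ultimately have "d \<le> i mod d" unfolding d_def by (intro Least_le) simp
    moreover have "i mod d < d" using d(1) by simp
    ultimately show False by simp
  qed
  then have "d = 1" using non_arith d(1) by (metis le_neq_implies_less)
  then show ?thesis using mult[OF d(2), of x] by simp
qed

text \<open>Each cycle costs one factor \<open>c\<close> and uses up at least one point, so at most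
  \<open>n\<close> factors occur.\<close>

lemma cyc_gf_scale_le:
  assumes a: "\<And>j. 0 \<le> a j" and c: "1 \<le> c"
  shows "cyc_gf (\<lambda>j. c * a j) n \<le> c ^ n * cyc_gf a n"
proof (induction n rule: less_induct)
  case (less n)
  show ?case
  proof (cases "n = 0")
    case False
    have "real n * cyc_gf (\<lambda>j. c * a j) n \<le> (\<Sum>l=1..n. c ^ n * (a l * cyc_gf a (n - l)))"
      unfolding cyc_gf_rec
    proof (rule sum_mono)
      fix l assume l: "l \<in> {1..n}"
      have "c * a l * cyc_gf (\<lambda>j. c * a j) (n - l) \<le> c * a l * (c ^ (n - l) * cyc_gf a (n - l))"
        using less l a c by (intro mult_left_mono) auto
      also have "\<dots> = c ^ Suc (n - l) * (a l * cyc_gf a (n - l))" by simp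
      also have "\<dots> \<le> c ^ n * (a l * cyc_gf a (n - l))"
        using l a c by (intro mult_right_mono power_increasing mult_nonneg_nonneg cyc_gf_nonneg) auto
      finally show "c * a l * cyc_gf (\<lambda>j. c * a j) (n - l) \<le> c ^ n * (a l * cyc_gf a (n - l))" .
    qed
    also have "\<dots> = c ^ n * (real n * cyc_gf a n)"
      by (simp only: cyc_gf_rec sum_distrib_left)
    finally show ?thesis using False by (simp add: mult.left_commute)
  qed simp
qed

text \<open>The indices with positive coefficient form an additive semigroup whose differences fill
  the integers. It therefore contains two consecutive numbers, and with them all large ones.\<close>

lemma cyc_gf_eventually_pos:
  assumes \<kappa>: "\<And>j. 0 \<le> \<kappa> j" and pos: "1 \<le> j" "\<kappa> j \<noteq> 0"
    and non_arith: "\<not> (\<exists>j0::nat. j0 > 1 \<and> (\<forall>j\<ge>1. \<kappa> j \<noteq> 0 \<longrightarrow> j0 dvd j))"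
  obtains n0 where "\<And>n. n \<ge> n0 \<Longrightarrow> 0 < cyc_gf \<kappa> n"
proof -
  define S where "S = {n. 0 < cyc_gf \<kappa> n}"
  have add: "m + n \<in> S" if "m \<in> S" "n \<in> S" for m n
  proof -
    have "0 < cyc_gf \<kappa> m * cyc_gf \<kappa> n" using that by (simp add: S_def)
    \<comment> \<open>Supermultiplicativity doubles the weights; rescaling returns to
      \<open>\<kappa>\<close> at the cost of a positive factor.\<close>
    also have "\<dots> \<le> cyc_gf (\<lambda>j. 2 * \<kappa> j) (m + n)"
      using cyc_gf_supermult[of \<kappa> \<kappa> m n] \<kappa> by simp
    also have "\<dots> \<le> 2 ^ (m + n) * cyc_gf \<kappa> (m + n)"
      by (rule cyc_gf_scale_le) (use \<kappa> in auto)
    finally show ?thesis by (simp add: S_def zero_less_mult_iff)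
  qed
  have zero: "0 \<in> S" by (simp add: S_def)
  have mult: "k * n \<in> S" if "n \<in> S" for k n
    by (induction k) (use zero add that in auto)
  have "(1::int) \<in> {int x - int y | x y. x \<in> S \<and> y \<in> S}"
  proof (rule int_subgroup_UNIV[OF _ _ pos non_arith])
    fix x y assume "x \<in> {int x - int y | x y. x \<in> S \<and> y \<in> S}" "y \<in> {int x - int y | x y. x \<in> S \<and> y \<in> S}"
    then obtain p q p' q' where "x = int p - int q" "y = int p' - int q'"
      and *: "p \<in> S" "q \<in> S" "p' \<in> S" "q' \<in> S" by auto
    then have "x - y = int (p + q') - int (q + p')" by simp
    with add * show "x - y \<in> {int x - int y | x y. x \<in> S \<and> y \<in> S}" by blast
  next
    fix i assume i: "1 \<le> i" "\<kappa> i \<noteq> 0"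
    have "\<kappa> i * cyc_gf \<kappa> (i - i) \<le> real i * cyc_gf \<kappa> i"
      by (rule cyc_gf_ge_term) (use \<kappa> i in auto)
    then have "0 < real i * cyc_gf \<kappa> i" using i \<kappa>[of i] by simp
    then have "i \<in> S" by (simp add: S_def zero_less_mult_iff)
    moreover have "int i = int i - int 0" by simp
    ultimately show "int i \<in> {int x - int y | x y. x \<in> S \<and> y \<in> S}"
      using zero by blast
  qed
  then obtain x y where "int x - int y = 1" and y: "x \<in> S" "y \<in> S" by auto
  then have "x = Suc y" by simp
  with y have y: "y \<in> S" "Suc y \<in> S" by auto
  \<comment> \<open>Here \<open>n mod y\<close> is below \<open>n div y\<close>, so
    \<open>n mod y\<close> of the \<open>n div y\<close> copies of \<open>y\<close> can be replaced
    by \<open>y + 1\<close>.\<close>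
  have "n \<in> S" if n: "n \<ge> y * y" for n
  proof (cases "y = 0")
    case True
    then show ?thesis using mult[OF y(2), of n] by simp
  next
    case False
    have "n mod y < y" using False by simp
    also have "y \<le> n div y" using n False by (simp add: less_eq_div_iff_mult_less_eq)
    finally have lt: "n mod y < n div y" .
    have "n = (n div y) * y + n mod y" by simp
    also have "\<dots> = (n div y - n mod y) * y + (n mod y) * Suc y"
      using lt by (simp add: algebra_simps diff_mult_distrib2)
    finally show ?thesis using add mult y by metis
  qed
  then show ?thesis using that by (auto simp: S_def)
qed

text \<open>Jensen's inequality for the number of cycles of length \<open>J\<close>: exponential tilting of the
  weight of \<open>J\<close>-cycles multiplies \<open>cyc_gf a n\<close> by an exponential moment of that number.\<close>
lemma cyc_gf_tilt:
  fixes a :: "nat \<Rightarrow> real" and t :: real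
  assumes a: "\<And>j. 0 \<le> a j" and J: "1 \<le> J" "J \<le> n" and pos: "cyc_gf a n > 0"
  shows "exp (t * (a J / real J * cyc_gf a (n - J) / cyc_gf a n)) * cyc_gf a n
    \<le> cyc_gf (a(J := exp t * a J)) n"
proof -
  \<comment> \<open>\<open>s u\<close> and \<open>b\<close> separate the \<open>J\<close>-cycles
    from all others, so \<open>c i\<close> below is the contribution with \<open>i\<close> points in
    \<open>J\<close>-cycles, that is with \<open>i / J\<close> such cycles.\<close>
  define s where "s = (\<lambda>u. cyc_gf (\<lambda>i. if i = J then u else 0))"
  define b where "b = cyc_gf (a(J := 0))"
  have split: "cyc_gf (a(J := u)) m = (\<Sum>i\<le>m. s u i * b (m - i))" for u m
  proof -
    have "a(J := u) = (\<lambda>i. (if i = J then u else 0) + (a(J := 0)) i)" by auto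
    then show ?thesis using cyc_gf_add[of "\<lambda>i. if i = J then u else 0" "a(J := 0)" m]
      by (simp add: s_def b_def)
  qed
  have shift: "real i * s u i = (if J \<le> i then u * s u (i - J) else 0)" for u i
  proof -
    have "real i * s u i = (\<Sum>l=1..i. if l = J then u * s u (i - J) else 0)"
      unfolding s_def cyc_gf_rec by (intro sum.cong) auto
    then show ?thesis using J by (simp add: sum.delta)
  qed
  define c where "c = (\<lambda>i. s (a J) i * b (n - i))"
  have c: "0 \<le> c i" for i
    unfolding c_def s_def b_def by (intro mult_nonneg_nonneg cyc_gf_nonneg) (auto simp: a)
  define m where "m = cyc_gf a n"
  define \<mu> where "\<mu> = a J / real J * cyc_gf a (n - J) / m"
  have m: "m = (\<Sum>i\<le>n. c i)" using split[of "a J" n] by (simp add: m_def c_def)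
  \<comment> \<open>The recursion \<open>shift\<close> removes one \<open>J\<close>-cycle and so
    turns the mean into the coefficient at \<open>n - J\<close>.\<close>
  have mean: "(\<Sum>i\<le>n. real i / real J * c i) = \<mu> * m"
  proof -
    have "(\<Sum>i\<le>n. real i / real J * c i) = (\<Sum>i\<le>n. (real i * s (a J) i) * b (n - i) / real J)"
      by (intro sum.cong) (auto simp: c_def)
    also have "\<dots> = (\<Sum>i\<in>{J..n}. a J / real J * (s (a J) (i - J) * b (n - i)))"
      unfolding shift by (intro sum.mono_neutral_cong_right) auto
    also have "\<dots> = (\<Sum>i\<le>n - J. a J / real J * (s (a J) i * b (n - J - i)))"
      by (rule sum.reindex_bij_witness[where i = "\<lambda>i. i + J" and j = "\<lambda>i. i - J"]) (use J in auto)
    also have "\<dots> = a J / real J * cyc_gf a (n - J)"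
      using split[of "a J" "n - J"] by (simp add: sum_distrib_left)
    finally show ?thesis using pos by (simp add: \<mu>_def m_def)
  qed
  have tilt: "s (exp t * a J) i = exp (t * (real i / real J)) * s (a J) i" for i
  proof (cases "J dvd i")
    case True
    then obtain k where "i = J * k" by auto
    then show ?thesis using J
      by (simp add: s_def cyc_gf_single power_mult_distrib power_divide exp_of_nat_mult[symmetric] mult.commute)
  qed (use J in \<open>simp add: s_def cyc_gf_single\<close>)
  \<comment> \<open>Expansion around the mean: \<open>1 + x \<le> e^x\<close> is used with
    \<open>x = t (i / J - \<mu>)\<close>, whose average vanishes.\<close>
  have "exp (t * \<mu>) * m = exp (t * \<mu>) * ((1 - t * \<mu>) * m + t * (\<mu> * m))"
    by (simp add: algebra_simps)
  also have "\<dots> = (\<Sum>i\<le>n. exp (t * \<mu>) * (1 + (t * (real i / real J) - t * \<mu>)) * c i)"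
    unfolding mean[symmetric] unfolding m sum_distrib_left sum.distrib[symmetric]
    by (intro sum.cong) (auto simp: algebra_simps)
  also have "\<dots> \<le> (\<Sum>i\<le>n. exp (t * \<mu>) * exp (t * (real i / real J) - t * \<mu>) * c i)"
    by (intro sum_mono mult_right_mono mult_left_mono exp_ge_add_one_self c) auto
  also have "\<dots> = (\<Sum>i\<le>n. s (exp t * a J) i * b (n - i))"
    unfolding tilt c_def by (intro sum.cong) (auto simp flip: exp_add)
  also have "\<dots> = cyc_gf (a(J := exp t * a J)) n" by (rule split[symmetric])
  finally show ?thesis by (simp add: \<mu>_def m_def)
qed

section \<open>Ratio limits at the critical radius\<close>

text \<open>The properties of \<open>r_*\<close> on which the limit rests. Partial sums are used so
  that \<open>r\<close> may lie on the boundary of convergence; \<open>mass_eq\<close> says that the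
  mass is exactly 1 once \<open>g_\<kappa>\<close> converges somewhere beyond
  \<open>r\<close>.\<close>

locale critical_radius =
  fixes \<theta> \<kappa> :: "nat \<Rightarrow> real" and r :: real
  assumes theta_nonneg: "\<And>j. 0 \<le> \<theta> j" and kappa_nonneg: "\<And>j. 0 \<le> \<kappa> j"
    and non_arith: "\<not> (\<exists>j0::nat. j0 > 1 \<and> (\<forall>j\<ge>1. \<kappa> j \<noteq> 0 \<longrightarrow> j0 dvd j))"
    and kappa_pos: "\<exists>j\<ge>2. \<kappa> j > 0"
    and r_pos: "0 < r"
    and mass_le: "\<And>M. (\<Sum>j=1..M. \<kappa> j * r ^ j) \<le> 1"
    and mass_eq: "\<And>s. r < s \<Longrightarrow> summable (\<lambda>j. \<kappa> j / real j * s ^ j) \<Longrightarrow>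
       (\<lambda>M. \<Sum>j=1..M. \<kappa> j * r ^ j) \<longlonglongrightarrow> 1"
    and theta_summable: "\<And>s. 0 < s \<Longrightarrow> s < r \<Longrightarrow> summable (\<lambda>j. \<theta> j / real j * s ^ j)"
begin

section \<open>Minimality of \<open>g_\<kappa> - ln\<close> at \<open>r\<close>\<close>

definition g_at_r :: real where "g_at_r = (\<Sum>j. \<kappa> j * r ^ j / real j)"

lemma sum_lessThan_Suc_0: "f 0 = 0 \<Longrightarrow> sum f {..<Suc M} = (\<Sum>j=1..M. f j)" for f :: "nat \<Rightarrow> real"
  by (simp only: lessThan_Suc_atMost atMost_atLeast0 sum.atLeast_Suc_atMost[of 0 M] One_nat_def)

lemma summable_g_at_r: "summable (\<lambda>j. \<kappa> j * r ^ j / real j)"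
proof (rule summableI_nonneg_bounded[where x = 1])
  fix n
  have "sum (\<lambda>j. \<kappa> j * r ^ j / real j) {..<n} \<le> sum (\<lambda>j. \<kappa> j * r ^ j / real j) {..<Suc n}"
    using r_pos by (intro sum_mono2) (auto simp: kappa_nonneg)
  \<comment> \<open>The term at 0 vanishes because division by 0 yields 0.\<close>
  also have "\<dots> = (\<Sum>j=1..n. \<kappa> j * r ^ j / real j)" by (rule sum_lessThan_Suc_0) simp
  also have "\<dots> \<le> (\<Sum>j=1..n. \<kappa> j * r ^ j)"
  proof (rule sum_mono)
    fix j assume "j \<in> {1..n}"
    then have "\<kappa> j * r ^ j / real j \<le> \<kappa> j * r ^ j / 1"
      using r_pos kappa_nonneg by (intro divide_left_mono) auto
    then show "\<kappa> j * r ^ j / real j \<le> \<kappa> j * r ^ j" by simp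
  qed
  also have "\<dots> \<le> 1" by (rule mass_le)
  finally show "sum (\<lambda>j. \<kappa> j * r ^ j / real j) {..<n} \<le> 1" .
qed (use r_pos kappa_nonneg in auto)

lemma g_at_r_tendsto: "(\<lambda>M. \<Sum>j=1..M. \<kappa> j * r ^ j / real j) \<longlonglongrightarrow> g_at_r"
proof -
  have "(\<lambda>M. sum (\<lambda>j. \<kappa> j * r ^ j / real j) {..<Suc M}) \<longlonglongrightarrow> g_at_r"
    unfolding g_at_r_def by (rule LIMSEQ_Suc[OF summable_LIMSEQ[OF summable_g_at_r]])
  moreover have "sum (\<lambda>j. \<kappa> j * r ^ j / real j) {..<Suc M} = (\<Sum>j=1..M. \<kappa> j * r ^ j / real j)" for M
    by (rule sum_lessThan_Suc_0) simp
  ultimately show ?thesis by (simp only:)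
qed

text \<open>The supporting line gives \<open>g_\<kappa>(\<rho>) - ln \<rho> \<le> L\<close> for some
  \<open>\<rho>\<close>. In the variable \<open>ln \<rho>\<close> the left side is convex with slope
  mass minus 1 at \<open>r\<close>. For \<open>\<rho> \<le> r\<close> a mass at most 1 suffices; for
  \<open>\<rho> > r\<close> convergence at \<open>\<rho>\<close> forces mass 1.\<close>

lemma diagonal_growth_lower:
  assumes L: "\<And>K. cyc_gf (\<lambda>j. real K * \<kappa> j) K \<le> exp (real K * L)"
  shows "g_at_r - ln r \<le> L"
proof -
  obtain j where j: "j \<ge> 2" "\<kappa> j > 0" using kappa_pos by auto
  obtain \<rho> where \<rho>: "\<rho> > 0"
    "\<And>k n. k \<ge> 1 \<Longrightarrow> cyc_gf (\<lambda>j. real k * \<kappa> j) n * \<rho> ^ n \<le> (exp L * \<rho>) ^ k"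
    using cyc_gf_supporting_line[OF kappa_nonneg j L] by blast
  let ?G = "\<lambda>t M. \<Sum>j=1..M. \<kappa> j * t ^ j / real j" and ?S = "\<lambda>M. \<Sum>j=1..M. \<kappa> j * r ^ j"
  have up: "?G \<rho> M \<le> L + ln \<rho>" for M
    by (rule exp_sum_le_of_supporting_line[OF kappa_nonneg \<rho>])
  have low: "?G r M + ln (\<rho> / r) * ?S M \<le> L + ln \<rho>" for M
    using sum_power_diff_ge_ln[of r \<rho> \<kappa> M, OF r_pos \<rho>(1) kappa_nonneg] up[of M] by simp
  have ln: "ln (\<rho> / r) = ln \<rho> - ln r" using \<rho> r_pos by (simp add: ln_div)
  show ?thesis
  proof (cases "\<rho> \<le> r")
    case True
    have "?G r M \<le> L + ln r" for M
    proof -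
      have "ln (\<rho> / r) \<le> 0" using True \<rho> r_pos by simp
      then have "ln (\<rho> / r) * 1 \<le> ln (\<rho> / r) * ?S M"
        by (intro mult_left_mono_neg mass_le)
      then show ?thesis using low[of M] ln by simp
    qed
    then have "g_at_r \<le> L + ln r"
      by (intro LIMSEQ_le_const2[OF g_at_r_tendsto]) blast
    then show ?thesis by simp
  next
    case False
    have "summable (\<lambda>j. \<kappa> j / real j * \<rho> ^ j)"
    proof (rule summableI_nonneg_bounded[where x = "L + ln \<rho>"])
      fix n
      have "(\<Sum>j<n. \<kappa> j / real j * \<rho> ^ j) \<le> (\<Sum>j<Suc n. \<kappa> j / real j * \<rho> ^ j)"
        using \<rho>(1) by (intro sum_mono2) (auto simp: kappa_nonneg)
      also have "\<dots> = (\<Sum>j=1..n. \<kappa> j / real j * \<rho> ^ j)" by (rule sum_lessThan_Suc_0) simp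
      finally show "(\<Sum>j<n. \<kappa> j / real j * \<rho> ^ j) \<le> L + ln \<rho>" using up[of n] by simp
    qed (use \<rho>(1) kappa_nonneg in auto)
    then have "?S \<longlonglongrightarrow> 1" using False by (intro mass_eq[of \<rho>]) auto
    then have "(\<lambda>M. ?G r M + ln (\<rho> / r) * ?S M) \<longlonglongrightarrow> g_at_r + ln (\<rho> / r) * 1"
      by (intro tendsto_intros g_at_r_tendsto)
    then have "g_at_r + ln (\<rho> / r) * 1 \<le> L + ln \<rho>"
      by (rule LIMSEQ_le_const2) (use low in blast)
    then show ?thesis using ln by simp
  qed
qed

section \<open>Growth of the coefficients at index \<open>N + p\<close>\<close>

abbreviation a :: "nat \<Rightarrow> nat \<Rightarrow> real" where
  "a N \<equiv> \<lambda>j. \<theta> j + real N * \<kappa> j"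

text \<open>The weights keep the parameter \<open>N\<close> while the number of points is shifted,
  in either direction. The truncation by \<open>nat\<close> only affects
  \<open>N < -p\<close>.\<close>

definition gf_shift :: "nat \<Rightarrow> int \<Rightarrow> real" where
  "gf_shift N p = cyc_gf (a N) (nat (int N + p))"

lemma a_nonneg: "0 \<le> a N j"
  by (simp add: theta_nonneg kappa_nonneg)

text \<open>By \<open>diagonal_growth_lower\<close> some diagonal block of size \<open>K\<close>
  grows almost optimally. Copies of it exhaust \<open>N\<close> up to a bounded rest, which absorbs
  the shift \<open>p\<close> and contributes at least a fixed positive factor.\<close>

lemma gf_shift_lower:
  assumes \<epsilon>: "0 < \<epsilon>"
  shows "eventually (\<lambda>N. exp (real N * (g_at_r - ln r - \<epsilon>)) \<le> gf_shift N p) sequentially"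
proof -
  define E where "E = g_at_r - ln r - \<epsilon> / 2"
  have "\<not> (\<forall>K. cyc_gf (\<lambda>j. real K * \<kappa> j) K \<le> exp (real K * E))"
  proof
    assume "\<forall>K. cyc_gf (\<lambda>j. real K * \<kappa> j) K \<le> exp (real K * E)"
    then have "g_at_r - ln r \<le> E" by (intro diagonal_growth_lower) blast
    then show False using \<epsilon> by (simp add: E_def)
  qed
  then obtain K where K: "exp (real K * E) < cyc_gf (\<lambda>j. real K * \<kappa> j) K"
    by (auto simp: not_le)
  have "K \<noteq> 0" using K by (intro notI) simp
  then have K0: "1 \<le> K" by simp
  obtain j where j: "j \<ge> 2" "\<kappa> j > 0" using kappa_pos by auto
  then have "1 \<le> j" "\<kappa> j \<noteq> 0" by auto
  then obtain n0 where n0: "\<And>n. n \<ge> n0 \<Longrightarrow> 0 < cyc_gf \<kappa> n"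
    using cyc_gf_eventually_pos[OF kappa_nonneg _ _ non_arith] by blast
  \<comment> \<open>\<open>B\<close> ensures \<open>b + p \<ge> n0\<close> for all
    \<open>b \<ge> B\<close>, so the rest has positive weight whatever its residue modulo
    \<open>K\<close>.\<close>
  define B where "B = (n0 + nat \<bar>p\<bar> + 1) * K"
  have "(n0 + nat \<bar>p\<bar> + 1) * 1 \<le> (n0 + nat \<bar>p\<bar> + 1) * K"
    by (rule mult_le_mono2[OF K0])
  then have B: "n0 + nat \<bar>p\<bar> + 1 \<le> B" by (simp add: B_def)
  define c where "c = Min ((\<lambda>b. cyc_gf \<kappa> (nat (int b + p))) ` {B..<B + K})"
  have "c \<in> (\<lambda>b. cyc_gf \<kappa> (nat (int b + p))) ` {B..<B + K}"
    unfolding c_def by (rule Min_in) (use K0 in auto)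
  then obtain b where "c = cyc_gf \<kappa> (nat (int b + p))" "B \<le> b" by auto
  then have c: "0 < c" using n0 B by simp
  have c_le: "c \<le> cyc_gf \<kappa> (nat (int b + p))" if "B \<le> b" "b < B + K" for b
    unfolding c_def by (rule Min_le) (use that in auto)
  have main: "exp (real N * E - real (B + K) * \<bar>E\<bar>) * c \<le> gf_shift N p" if N: "B \<le> N" for N
  proof -
    define q b where "q = (N - B) div K" and "b = B + (N - B) mod K"
    have b: "B \<le> b" "b < B + K" "N = q * K + b"
      using K0 N by (auto simp: q_def b_def)
    have nat: "nat (int N + p) = q * K + nat (int b + p)"
      using b(1,3) B by (simp add: nat_add_distrib nat_mult_distrib add.assoc)
    \<comment> \<open>\<open>E\<close> may have either sign, so the rest is charged with
      \<open>\<bar>E\<bar>\<close> per point.\<close>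
    have "real N * E - real (B + K) * \<bar>E\<bar> \<le> real N * E - real b * \<bar>E\<bar>"
      using b(2) by (intro diff_left_mono mult_right_mono) auto
    also have "\<dots> \<le> real N * E - real b * E"
      by (intro diff_left_mono mult_left_mono) auto
    also have "\<dots> = real q * (real K * E)" by (simp add: b(3) algebra_simps)
    finally have "exp (real N * E - real (B + K) * \<bar>E\<bar>) \<le> exp (real K * E) ^ q"
      by (simp flip: exp_of_nat_mult)
    also have "\<dots> \<le> cyc_gf (\<lambda>j. real K * \<kappa> j) K ^ q"
      using K by (intro power_mono) auto
    also have "\<dots> \<le> cyc_gf (\<lambda>j. real (q * K) * \<kappa> j) (q * K)"
      by (rule cyc_gf_power_le[OF kappa_nonneg])
    finally have 1: "exp (real N * E - real (B + K) * \<bar>E\<bar>) \<le> cyc_gf (\<lambda>j. real (q * K) * \<kappa> j) (q * K)" .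
    have "1 * \<kappa> j \<le> real b * \<kappa> j" for j
      using b(1) B by (intro mult_right_mono kappa_nonneg) auto
    then have "cyc_gf \<kappa> (nat (int b + p)) \<le> cyc_gf (\<lambda>j. real b * \<kappa> j) (nat (int b + p))"
      by (intro cyc_gf_mono) (auto simp: kappa_nonneg)
    then have 2: "c \<le> cyc_gf (\<lambda>j. real b * \<kappa> j) (nat (int b + p))"
      using c_le[OF b(1,2)] by simp
    have "exp (real N * E - real (B + K) * \<bar>E\<bar>) * c
       \<le> cyc_gf (\<lambda>j. real (q * K) * \<kappa> j) (q * K) * cyc_gf (\<lambda>j. real b * \<kappa> j) (nat (int b + p))"
      using 1 2 c by (intro mult_mono cyc_gf_nonneg) (auto simp: kappa_nonneg)
    also have "\<dots> \<le> cyc_gf (\<lambda>j. real (q * K + b) * \<kappa> j) (q * K + nat (int b + p))"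
      by (rule cyc_gf_scale_supermult[OF kappa_nonneg])
    also have "\<dots> \<le> gf_shift N p"
      unfolding gf_shift_def nat b(3)[symmetric]
      by (intro cyc_gf_mono) (auto simp: kappa_nonneg theta_nonneg)
    finally show ?thesis .
  qed
  \<comment> \<open>From here on the bounded loss is covered by the spare
    \<open>\<epsilon> / 2\<close> per unit of \<open>N\<close>.\<close>
  have "eventually (\<lambda>N. B \<le> N \<and> (real (B + K) * \<bar>E\<bar> - ln c) / (\<epsilon> / 2) \<le> real N) sequentially"
    by (intro eventually_conj eventually_ge_at_top) real_asymp
  then show ?thesis
  proof (rule eventually_mono)
    fix N assume N: "B \<le> N \<and> (real (B + K) * \<bar>E\<bar> - ln c) / (\<epsilon> / 2) \<le> real N"
    then have "real (B + K) * \<bar>E\<bar> - ln c \<le> real N * (\<epsilon> / 2)"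
      using \<epsilon> by (subst (asm) pos_divide_le_eq) auto
    then have "real N * (g_at_r - ln r - \<epsilon>) \<le> real N * E - real (B + K) * \<bar>E\<bar> + ln c"
      by (simp add: E_def algebra_simps)
    then have "exp (real N * (g_at_r - ln r - \<epsilon>)) \<le> exp (real N * E - real (B + K) * \<bar>E\<bar> + ln c)"
      by simp
    also have "\<dots> = exp (real N * E - real (B + K) * \<bar>E\<bar>) * c"
      using c by (simp add: exp_add)
    also have "\<dots> \<le> gf_shift N p" using main N by blast
    finally show "exp (real N * (g_at_r - ln r - \<epsilon>)) \<le> gf_shift N p" .
  qed
qed

lemma gf_shift_pos: "eventually (\<lambda>N. 0 < gf_shift N p) sequentially"
  using gf_shift_lower[of 1 p, OF zero_less_one]
  by (rule eventually_mono) (rule less_le_trans[OF exp_gt_zero])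

text \<open>For \<open>N + p \<ge> J\<close> this is the expected number of \<open>J\<close>-cycles
  in a permutation of \<open>N + p\<close> points with weights \<open>a N\<close>.\<close>

definition cycle_mean :: "nat \<Rightarrow> int \<Rightarrow> nat \<Rightarrow> real" where
  "cycle_mean N p J = a N J / real J * gf_shift N (p - int J) / gf_shift N p"

text \<open>The tilted coefficient is at least \<open>e^(t * mean)\<close> times the untilted one,
  which has a lower growth bound, and at most its saddle point bound at some \<open>s\<close> just
  below \<open>r\<close>. Per unit of \<open>N\<close> only the effect of the tilt on
  \<open>g_\<kappa>\<close> survives.\<close>

lemma cycle_mean_tilt:
  assumes J: "1 \<le> J" and t: "t \<noteq> 0" and e: "0 < e"
  shows "eventually (\<lambda>N. t * (cycle_mean N p J / real N) \<le> (exp t - 1) * (\<kappa> J * r ^ J / real J) + e) sequentially"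
proof -
  let ?x = "\<kappa> J * r ^ J / real J"
  \<comment> \<open>\<open>\<epsilon>\<close> enters twice, through the lower growth bound and
    through \<open>ln s = ln r - \<epsilon>\<close>; hence the summand
    \<open>2 * \<epsilon>\<close>.\<close>
  have "((\<lambda>\<epsilon>. 2 * \<epsilon> + (exp t - 1) * (?x * exp (- real J * \<epsilon>))) \<longlongrightarrow> 2 * 0 + (exp t - 1) * (?x * exp (- real J * 0))) (at_right 0)"
    by (intro tendsto_intros)
  then have "eventually (\<lambda>\<epsilon>. 2 * \<epsilon> + (exp t - 1) * (?x * exp (- real J * \<epsilon>)) < (exp t - 1) * ?x + e / 2) (at_right 0)"
    by (rule order_tendstoD) (use e in simp)
  moreover have "eventually (\<lambda>\<epsilon>::real. 0 < \<epsilon>) (at_right 0)"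
    by (rule eventually_at_right_less)
  ultimately have "eventually (\<lambda>\<epsilon>. 2 * \<epsilon> + (exp t - 1) * (?x * exp (- real J * \<epsilon>)) < (exp t - 1) * ?x + e / 2 \<and> 0 < \<epsilon>) (at_right 0)"
    by (rule eventually_conj)
  then obtain \<epsilon> where \<epsilon>: "2 * \<epsilon> + (exp t - 1) * (?x * exp (- real J * \<epsilon>)) < (exp t - 1) * ?x + e / 2" "0 < \<epsilon>"
    using eventually_happens'[OF trivial_limit_at_right_real] by blast
  define s where "s = r * exp (- \<epsilon>)"
  have s: "0 < s" "s < r" using r_pos \<epsilon>(2) by (auto simp: s_def)
  have ln_s: "ln s = ln r - \<epsilon>" using r_pos by (simp add: s_def ln_mult)
  have s_pow: "s ^ J = r ^ J * exp (- real J * \<epsilon>)"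
    by (simp add: s_def power_mult_distrib exp_of_nat_mult[symmetric])
  define \<Theta> where "\<Theta> = (\<Sum>j. \<theta> j / real j * s ^ j)"
  \<comment> \<open>\<open>C\<close> collects the terms that do not grow with
    \<open>N\<close>.\<close>
  define C where "C = \<Theta> + (exp t - 1) * \<theta> J * s ^ J / real J - p * ln s"
  have "((\<lambda>N. C / real N) \<longlongrightarrow> 0) sequentially" by real_asymp
  then have "eventually (\<lambda>N. C / real N < e / 2) sequentially"
    by (rule order_tendstoD) (use e in simp)
  moreover note gf_shift_lower[OF \<epsilon>(2), of p]
  moreover have "eventually (\<lambda>N. int J + \<bar>p\<bar> \<le> int N) sequentially"
    using eventually_ge_at_top[of "J + nat \<bar>p\<bar>"] by (rule eventually_mono) linarith
  ultimately show ?thesis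
  proof eventually_elim
    fix N
    assume C: "C / real N < e / 2" and low: "exp (real N * (g_at_r - ln r - \<epsilon>)) \<le> gf_shift N p"
      and N: "int J + \<bar>p\<bar> \<le> int N"
    define n where "n = nat (int N + p)"
    have n: "J \<le> n" "real n = real N + p" "nat (int N + (p - int J)) = n - J" and N0: "0 < real N"
      using N J by (auto simp: n_def nat_diff_distrib algebra_simps)
    have Fpos: "0 < gf_shift N p" using low by (rule less_le_trans[OF exp_gt_zero])
    define \<mu> where "\<mu> = cycle_mean N p J"
    let ?b = "(a N)(J := exp t * a N J)"
    have "exp (t * \<mu>) * gf_shift N p \<le> cyc_gf ?b n"
      using cyc_gf_tilt[of "a N" J n t] a_nonneg J n Fpos
      by (simp add: \<mu>_def cycle_mean_def gf_shift_def n_def[symmetric])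
    then have "exp (t * \<mu>) * gf_shift N p * s ^ n \<le> cyc_gf ?b n * s ^ n"
      using s by (intro mult_right_mono) auto
    also have "\<dots> \<le> exp (\<Sum>j=1..n. ?b j * s ^ j / real j)"
      by (rule cyc_gf_upper) (use a_nonneg s in auto)
    also have "(\<Sum>j=1..n. ?b j * s ^ j / real j)
      = (\<Sum>j=1..n. a N j * s ^ j / real j + (if j = J then (exp t - 1) * a N J * s ^ J / real J else 0))"
      by (intro sum.cong) (auto simp: field_simps)
    also have "\<dots> = (\<Sum>j=1..n. \<theta> j / real j * s ^ j) + real N * (\<Sum>j=1..n. \<kappa> j * s ^ j / real j)
       + (exp t - 1) * a N J * s ^ J / real J"
      using J n(1) by (simp add: sum.distrib sum.delta sum_distrib_left algebra_simps add_divide_distrib)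
    also have "exp \<dots> \<le> exp (\<Theta> + real N * g_at_r + (exp t - 1) * a N J * s ^ J / real J)"
    proof -
      have "(\<Sum>j=1..n. \<theta> j / real j * s ^ j) \<le> \<Theta>"
        unfolding \<Theta>_def using s theta_nonneg
        by (intro sum_le_suminf theta_summable) auto
      moreover have "(\<Sum>j=1..n. \<kappa> j * s ^ j / real j) \<le> g_at_r"
      proof -
        have "(\<Sum>j=1..n. \<kappa> j * s ^ j / real j) \<le> (\<Sum>j=1..n. \<kappa> j * r ^ j / real j)"
          using s kappa_nonneg by (intro sum_mono divide_right_mono mult_left_mono power_mono) auto
        also have "\<dots> \<le> g_at_r"
          unfolding g_at_r_def using kappa_nonneg r_pos by (intro sum_le_suminf summable_g_at_r) auto
        finally show ?thesis .
      qed
      ultimately show ?thesis by (simp add: add_mono mult_left_mono)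
    qed
    finally have up: "exp (t * \<mu>) * gf_shift N p * s ^ n
       \<le> exp (\<Theta> + real N * g_at_r + (exp t - 1) * a N J * s ^ J / real J)" .
    have "s ^ n = exp (real n * ln s)" using s by (simp add: exp_of_nat_mult)
    then have "exp (t * \<mu> + real N * (g_at_r - ln r - \<epsilon>) + real n * ln s)
       = exp (t * \<mu>) * exp (real N * (g_at_r - ln r - \<epsilon>)) * s ^ n"
      by (simp only: exp_add)
    also have "\<dots> \<le> exp (t * \<mu>) * gf_shift N p * s ^ n"
      using low s by (intro mult_right_mono mult_left_mono) auto
    also note up
    finally have "exp (t * \<mu> + real N * (g_at_r - ln r - \<epsilon>) + real n * ln s)
       \<le> exp (\<Theta> + real N * g_at_r + (exp t - 1) * a N J * s ^ J / real J)" .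
    then have "t * \<mu> + real N * (g_at_r - ln r - \<epsilon>) + real n * ln s
       \<le> \<Theta> + real N * g_at_r + (exp t - 1) * a N J * s ^ J / real J" by simp
    then have "t * \<mu> \<le> C + real N * (2 * \<epsilon> + (exp t - 1) * (?x * exp (- real J * \<epsilon>)))"
      unfolding C_def n(2) s_pow by (simp add: ln_s algebra_simps add_divide_distrib diff_divide_distrib)
    then have "t * \<mu> / real N \<le> C / real N + (2 * \<epsilon> + (exp t - 1) * (?x * exp (- real J * \<epsilon>)))"
      using N0 by (simp add: field_simps)
    then show "t * (cycle_mean N p J / real N) \<le> (exp t - 1) * ?x + e"
      using \<epsilon>(1) C unfolding \<mu>_def times_divide_eq_right by linarith
  qed
qed

text \<open>Dividing the tilt inequality by a small \<open>t\<close> of either sign gives an upper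
  and a lower bound, and \<open>(e^t - 1) / t\<close> tends to 1.\<close>

lemma cycle_mean_tendsto:
  assumes J: "1 \<le> J"
  shows "(\<lambda>N. cycle_mean N p J / real N) \<longlonglongrightarrow> \<kappa> J * r ^ J / real J"
proof (rule tendstoI)
  fix e :: real assume e: "0 < e"
  let ?x = "\<kappa> J * r ^ J / real J"
  have lim: "((\<lambda>t::real. (exp t - 1) / t) \<longlongrightarrow> 1) (at 0)"
    using DERIV_exp[of "0::real"] by (simp add: DERIV_def)
  have "((\<lambda>t::real. (exp t - 1) / t * ?x) \<longlongrightarrow> 1 * ?x) (at 0)"
    by (intro tendsto_mult lim tendsto_const)
  then have "eventually (\<lambda>t. dist ((exp t - 1) / t * ?x) ?x < e / 2) (at 0)"
    using tendstoD[of _ "1 * ?x" "at 0" "e / 2"] e by simp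
  then obtain d where d: "d > 0" "\<And>t. t \<noteq> 0 \<Longrightarrow> dist t 0 < d \<Longrightarrow> dist ((exp t - 1) / t * ?x) ?x < e / 2"
    unfolding eventually_at by auto
  define t where "t = d / 2"
  have t: "t > 0" "t \<noteq> 0" "dist t 0 < d" "dist (- t) 0 < d" using d by (auto simp: t_def)
  have "eventually (\<lambda>N. t * (cycle_mean N p J / real N) \<le> (exp t - 1) * ?x + t * e / 2) sequentially"
    using cycle_mean_tilt[OF J, of t "t * e / 2" p] t e by simp
  moreover have "eventually (\<lambda>N. (- t) * (cycle_mean N p J / real N) \<le> (exp (- t) - 1) * ?x + t * e / 2) sequentially"
    using cycle_mean_tilt[OF J, of "- t" "t * e / 2" p] t e by simp
  ultimately show "eventually (\<lambda>N. dist (cycle_mean N p J / real N) ?x < e) sequentially"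
  proof eventually_elim
    fix N
    define y where "y = cycle_mean N p J / real N"
    assume 1: "t * (cycle_mean N p J / real N) \<le> (exp t - 1) * ?x + t * e / 2"
      and 2: "(- t) * (cycle_mean N p J / real N) \<le> (exp (- t) - 1) * ?x + t * e / 2"
    have "y \<le> ((exp t - 1) * ?x + t * e / 2) / t"
      using 1 t(1) unfolding y_def[symmetric] by (subst pos_le_divide_eq) (simp_all only: mult.commute)
    then have "y \<le> (exp t - 1) / t * ?x + e / 2"
      using t(1) by (simp add: add_divide_distrib mult.commute)
    moreover have "((exp (- t) - 1) * ?x + t * e / 2) / (- t) \<le> y"
      using 2 t(1) unfolding y_def[symmetric] by (subst neg_divide_le_eq) (simp_all add: mult.commute)
    moreover have "((exp (- t) - 1) * ?x + t * e / 2) / (- t) = (exp (- t) - 1) / (- t) * ?x - e / 2"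
      using t(1) J by (simp add: field_simps)
    ultimately have "y \<le> (exp t - 1) / t * ?x + e / 2" "(exp (- t) - 1) / (- t) * ?x - e / 2 \<le> y"
      by (simp_all only:)
    moreover have "(exp t - 1) / t * ?x < ?x + e / 2" "(exp (- t) - 1) / (- t) * ?x > ?x - e / 2"
      using d(2)[OF t(2,3)] d(2)[OF _ t(4)] t(2) unfolding dist_real_def by linarith+
    ultimately show "dist (cycle_mean N p J / real N) ?x < e"
      unfolding y_def[symmetric] by (simp add: dist_real_def abs_less_iff)
  qed
qed

lemma gf_shift_ratio_cycle:
  assumes J: "1 \<le> J" "\<kappa> J \<noteq> 0"
  shows "(\<lambda>N. gf_shift N (p - int J) / gf_shift N p) \<longlonglongrightarrow> r ^ J"
proof -
  have "(\<lambda>N. (\<theta> J / real N + \<kappa> J) / real J) \<longlonglongrightarrow> (0 + \<kappa> J) / real J"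
    by (intro tendsto_intros lim_const_over_n)  (use J in auto)
  then have "(\<lambda>N. cycle_mean N p J / real N / ((\<theta> J / real N + \<kappa> J) / real J))
     \<longlonglongrightarrow> (\<kappa> J * r ^ J / real J) / ((0 + \<kappa> J) / real J)"
    by (rule tendsto_divide[OF cycle_mean_tendsto[OF J(1)]]) (use J in simp)
  then have "(\<lambda>N. cycle_mean N p J / real N / ((\<theta> J / real N + \<kappa> J) / real J)) \<longlonglongrightarrow> r ^ J"
    using J by simp
  moreover have "eventually (\<lambda>N. cycle_mean N p J / real N / ((\<theta> J / real N + \<kappa> J) / real J)
     = gf_shift N (p - int J) / gf_shift N p) sequentially"
    using eventually_gt_at_top[of 0]
  proof eventually_elim
    fix N :: nat assume N: "0 < N"
    have "\<kappa> J > 0" using J kappa_nonneg[of J] by simp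
    then have "0 < real N * \<kappa> J" using N by simp
    then have "a N J > 0" using theta_nonneg[of J] by simp
    moreover have "(\<theta> J / real N + \<kappa> J) / real J = a N J / (real N * real J)"
      using N J by (simp add: field_simps)
    ultimately show "cycle_mean N p J / real N / ((\<theta> J / real N + \<kappa> J) / real J) = gf_shift N (p - int J) / gf_shift N p"
      unfolding cycle_mean_def using N J by simp
  qed
  ultimately show ?thesis by (rule Lim_transform_eventually)
qed

text \<open>The admissible \<open>d\<close>, required for all base points \<open>p\<close> at once,
  form a subgroup that contains the support of \<open>\<kappa>\<close>.\<close>

lemma gf_shift_ratio: "(\<lambda>N. gf_shift N (p - d) / gf_shift N p) \<longlonglongrightarrow> r powi d"
proof -
  let ?G = "{d. \<forall>p. (\<lambda>N. gf_shift N (p - d) / gf_shift N p) \<longlonglongrightarrow> r powi d}"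
  obtain j where j: "j \<ge> 2" "\<kappa> j > 0" using kappa_pos by auto
  then have j: "1 \<le> j" "\<kappa> j \<noteq> 0" by auto
  have "d \<in> ?G"
  proof (rule int_subgroup_UNIV[OF _ _ j non_arith])
    fix d e assume d: "d \<in> ?G" and e: "e \<in> ?G"
    show "d - e \<in> ?G"
    proof safe
      fix p
      \<comment> \<open>Both limits are taken at the base point \<open>p + e\<close>, whose
        coefficient cancels in the quotient.\<close>
      have "(\<lambda>N. gf_shift N (p + e - d) / gf_shift N (p + e)) \<longlonglongrightarrow> r powi d"
        using d by blast
      moreover have "(\<lambda>N. gf_shift N (p + e - e) / gf_shift N (p + e)) \<longlonglongrightarrow> r powi e"
        using e by blast
      ultimately have "(\<lambda>N. gf_shift N (p + e - d) / gf_shift N (p + e) / (gf_shift N (p + e - e) / gf_shift N (p + e)))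
         \<longlonglongrightarrow> r powi d / r powi e"
        using r_pos by (intro tendsto_divide) auto
      moreover have "eventually (\<lambda>N. gf_shift N (p + e - d) / gf_shift N (p + e) / (gf_shift N (p + e - e) / gf_shift N (p + e))
         = gf_shift N (p - (d - e)) / gf_shift N p) sequentially"
        using gf_shift_pos[of "p + e"] by eventually_elim (simp add: algebra_simps)
      moreover have "r powi d / r powi e = r powi (d - e)"
        using r_pos by (simp add: power_int_diff)
      ultimately show "(\<lambda>N. gf_shift N (p - (d - e)) / gf_shift N p) \<longlonglongrightarrow> r powi (d - e)"
        using Lim_transform_eventually by fastforce
    qed
  next
    fix i assume "1 \<le> i" "\<kappa> i \<noteq> 0"
    then show "int i \<in> ?G" using gf_shift_ratio_cycle by simp
  qed
  then show ?thesis by blast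
qed

text \<open>Each removed cycle contributes \<open>a N l / (N + p)\<close>, which tends to
  \<open>\<kappa> l\<close>, and a ratio with limit \<open>r^l\<close>. The shift is arbitrary
  because the remaining cycles start from \<open>p - l\<close>.\<close>

lemma lex_gf_ratio:
  assumes "\<forall>l\<in>set ls. 1 \<le> l"
  shows "(\<lambda>N. lex_gf (a N) (nat (int N + p)) ls / gf_shift N p) \<longlonglongrightarrow> (\<Prod>l\<leftarrow>ls. \<kappa> l * r ^ l)"
  using assms
proof (induction ls arbitrary: p)
  case Nil
  have "eventually (\<lambda>N. lex_gf (a N) (nat (int N + p)) [] / gf_shift N p = 1) sequentially"
    using gf_shift_pos[of p] by eventually_elim (simp add: gf_shift_def)
  then show ?case by (simp add: tendsto_eventually)
next
  case (Cons l ls)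
  let ?q = "p - int l"
  have lim1: "((\<lambda>N. (\<theta> l / real N + \<kappa> l) * (real N / (real N + p))) \<longlongrightarrow> (0 + \<kappa> l) * 1) sequentially"
    by (intro tendsto_mult tendsto_add lim_const_over_n tendsto_const) real_asymp
  have lim2: "(\<lambda>N. gf_shift N ?q / gf_shift N p) \<longlonglongrightarrow> r powi int l" by (rule gf_shift_ratio)
  have lim3: "(\<lambda>N. lex_gf (a N) (nat (int N + ?q)) ls / gf_shift N ?q) \<longlonglongrightarrow> (\<Prod>l\<leftarrow>ls. \<kappa> l * r ^ l)"
    using Cons by simp
  have "(\<lambda>N. (\<theta> l / real N + \<kappa> l) * (real N / (real N + p)) * (gf_shift N ?q / gf_shift N p)
      * (lex_gf (a N) (nat (int N + ?q)) ls / gf_shift N ?q))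
    \<longlonglongrightarrow> (0 + \<kappa> l) * 1 * r powi int l * (\<Prod>l\<leftarrow>ls. \<kappa> l * r ^ l)"
    by (rule tendsto_mult[OF tendsto_mult[OF lim1 lim2] lim3])
  moreover have "eventually (\<lambda>N. int l + \<bar>p\<bar> < int N) sequentially"
    using eventually_gt_at_top[of "l + nat \<bar>p\<bar>"] by (rule eventually_mono) linarith
  with gf_shift_pos[of ?q]
  have "eventually (\<lambda>N. (\<theta> l / real N + \<kappa> l) * (real N / (real N + p)) * (gf_shift N ?q / gf_shift N p)
      * (lex_gf (a N) (nat (int N + ?q)) ls / gf_shift N ?q)
    = lex_gf (a N) (nat (int N + p)) (l # ls) / gf_shift N p) sequentially"
  proof eventually_elim
    fix N assume pos: "0 < gf_shift N ?q" and N: "int l + \<bar>p\<bar> < int N"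
    define n where "n = nat (int N + p)"
    have n: "1 \<le> l" "l \<le> n" "nat (int N + ?q) = n - l" "real N + p = real n" "0 < real N"
      using N Cons.prems by (auto simp: n_def nat_diff_distrib algebra_simps)
    have "(\<theta> l / real N + \<kappa> l) * (real N / real n) = a N l / real n"
      using n by (simp add: field_simps)
    then show "(\<theta> l / real N + \<kappa> l) * (real N / (real N + p)) * (gf_shift N ?q / gf_shift N p)
      * (lex_gf (a N) (nat (int N + ?q)) ls / gf_shift N ?q)
      = lex_gf (a N) (nat (int N + p)) (l # ls) / gf_shift N p"
      using pos n by (simp add: n_def[symmetric])
  qed
  ultimately show ?case
    using Lim_transform_eventually by fastforce
qed

lemma PN_lexL_tendsto:
  assumes l: "\<And>j. 1 \<le> j \<Longrightarrow> j \<le> m \<Longrightarrow> 1 \<le> l j"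
  shows "(\<lambda>N. PN \<theta> \<kappa> N (\<lambda>\<sigma>. \<forall>j\<in>{1..m}. lexL N \<sigma> j = l j)) \<longlonglongrightarrow> (\<Prod>j=1..m. \<kappa> (l j) * r ^ l j)"
proof -
  have "(\<lambda>N. lex_gf (a N) (nat (int N + 0)) (map l [1..<Suc m]) / gf_shift N 0)
      \<longlonglongrightarrow> (\<Prod>l\<leftarrow>map l [1..<Suc m]. \<kappa> l * r ^ l)"
    by (rule lex_gf_ratio) (use l in auto)
  also have "(\<Prod>l\<leftarrow>map l [1..<Suc m]. \<kappa> l * r ^ l) = (\<Prod>j=1..m. \<kappa> (l j) * r ^ l j)"
    by (simp add: prod.distinct_set_conv_list[symmetric] atLeastLessThanSuc_atLeastAtMost o_def del: upt_Suc)
  finally have "(\<lambda>N. lex_gf (a N) N (map l [1..<Suc m]) / cyc_gf (a N) N)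
      \<longlonglongrightarrow> (\<Prod>j=1..m. \<kappa> (l j) * r ^ l j)"
    by (simp only: gf_shift_def add_0_right nat_int)
  moreover have "PN \<theta> \<kappa> N (\<lambda>\<sigma>. \<forall>j\<in>{1..m}. lexL N \<sigma> j = l j)
      = lex_gf (a N) N (map l [1..<Suc m]) / cyc_gf (a N) N" for N
    by (rule PN_lexL) (rule l)
  ultimately show ?thesis by (simp only:)
qed

end

section \<open>The critical radius under the analytic hypotheses\<close>

lemma gop1_sums:
  assumes r: "0 < r" "ereal r < grad \<kappa>"
  shows "(\<lambda>n. \<kappa> (Suc n) * r ^ Suc n) sums gop \<kappa> 1 r"
proof -
  let ?F = "Abs_fps (gcoef \<kappa>)"
  have F: "gfun \<kappa> = eval_fps ?F" by (auto simp: gfun_def eval_fps_def fun_eq_iff)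
  have R: "fps_conv_radius ?F = grad \<kappa>" by (simp add: fps_conv_radius_def grad_def)
  have z: "ereal (norm (complex_of_real r)) < fps_conv_radius ?F" using r R by simp
  have "deriv (gfun \<kappa>) (of_real r) = eval_fps (fps_deriv ?F) (of_real r)"
    unfolding F by (intro DERIV_imp_deriv has_field_derivative_eval_fps z)
  moreover have "(\<lambda>n. fps_nth (fps_deriv ?F) n * of_real r ^ n) sums eval_fps (fps_deriv ?F) (of_real r)"
    by (rule sums_eval_fps) (use z fps_conv_radius_deriv[of ?F] in \<open>auto intro: less_le_trans\<close>)
  ultimately have "(\<lambda>n. of_real r * (fps_nth (fps_deriv ?F) n * of_real r ^ n)) sums
      (of_real r * deriv (gfun \<kappa>) (of_real r))"
    by (simp add: sums_mult)
  moreover have "of_real r * (fps_nth (fps_deriv ?F) n * of_real r ^ n) = complex_of_real (\<kappa> (Suc n) * r ^ Suc n)" for n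
    by (simp add: gcoef_def del: of_nat_Suc)
  ultimately have "(\<lambda>n. complex_of_real (\<kappa> (Suc n) * r ^ Suc n)) sums (of_real r * deriv (gfun \<kappa>) (of_real r))"
    by (simp only:)
  from sums_Re[OF this] show ?thesis by (simp add: gop_def)
qed

text \<open>Strictness makes the root of \<open>g_\<kappa>^{1} = 1\<close> unique, as the
  description in \<open>rstar\<close> demands.\<close>

lemma gop1_strict_mono:
  assumes \<kappa>: "\<And>j. 0 \<le> \<kappa> j" "\<exists>j\<ge>2. \<kappa> j > 0"
    and rs: "0 < r" "r < s" "ereal s < grad \<kappa>"
  shows "gop \<kappa> 1 r < gop \<kappa> 1 s"
proof -
  have "ereal r < grad \<kappa>" using rs less_trans[of "ereal r" "ereal s"] by simp
  then have "(\<lambda>n. \<kappa> (Suc n) * s ^ Suc n - \<kappa> (Suc n) * r ^ Suc n) sums (gop \<kappa> 1 s - gop \<kappa> 1 r)"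
    using rs by (intro sums_diff gop1_sums) auto
  then have *: "(\<lambda>n. \<kappa> (Suc n) * (s ^ Suc n - r ^ Suc n)) sums (gop \<kappa> 1 s - gop \<kappa> 1 r)"
    by (simp only: right_diff_distrib)
  obtain j where j: "j \<ge> 2" "\<kappa> j > 0" using \<kappa> by auto
  have "s ^ j - r ^ j > 0" using j rs by (simp add: power_strict_mono)
  then have "0 < \<kappa> (Suc (j - 1)) * (s ^ Suc (j - 1) - r ^ Suc (j - 1))" using j by simp
  moreover have "0 \<le> \<kappa> (Suc n) * (s ^ Suc n - r ^ Suc n)" for n
    using \<kappa> rs power_mono[of r s "Suc n"] by (intro mult_nonneg_nonneg) auto
  ultimately have "0 < (\<Sum>n. \<kappa> (Suc n) * (s ^ Suc n - r ^ Suc n))"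
    using * by (intro suminf_pos2[of _ "j - 1"]) (auto simp: sums_iff)
  then show ?thesis using * by (simp add: sums_iff)
qed

lemma summable_real_coef:
  assumes "0 < s" "ereal s < grad a"
  shows "summable (\<lambda>j. a j / real j * s ^ j)"
proof -
  have "summable (\<lambda>j. gcoef a j * complex_of_real s ^ j)"
    using assms by (intro summable_in_conv_radius) (simp add: grad_def)
  from summable_Re[OF this] show ?thesis
    by (simp only: gcoef_def of_real_power[symmetric] of_real_mult[symmetric] Re_complex_of_real)
qed

lemma not_summable_real_coef:
  assumes "grad a < ereal s" "0 < s"
  shows "\<not> summable (\<lambda>j. a j / real j * s ^ j)"
proof
  assume "summable (\<lambda>j. a j / real j * s ^ j)"
  then have "summable (\<lambda>j. complex_of_real (a j / real j * s ^ j))"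
    by (rule summable_of_real)
  then have "summable (\<lambda>j. gcoef a j * complex_of_real s ^ j)"
    by (simp add: gcoef_def)
  moreover have "\<not> summable (\<lambda>j. gcoef a j * complex_of_real s ^ j)"
    using assms by (intro not_summable_outside_conv_radius) (simp add: grad_def)
  ultimately show False by blast
qed

lemma sum_kappa_le_gop1:
  assumes \<kappa>: "\<And>j. 0 \<le> \<kappa> j" and r: "0 < r" "ereal r < grad \<kappa>"
  shows "(\<Sum>j=1..M. \<kappa> j * r ^ j) \<le> gop \<kappa> 1 r"
proof -
  have "(\<Sum>j=1..M. \<kappa> j * r ^ j) = (\<Sum>n<M. \<kappa> (Suc n) * r ^ Suc n)"
    by (simp only: One_nat_def sum.atLeast1_atMost_eq)
  also have "\<dots> \<le> gop \<kappa> 1 r"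
    using gop1_sums[OF r] \<kappa> r by (subst sums_unique) (auto intro!: sum_le_suminf simp: sums_iff)
  finally show ?thesis .
qed

section \<open>Identification of \<open>rstar\<close>\<close>

context
  fixes \<theta> \<kappa> :: "nat \<Rightarrow> real"
  assumes theta_nonneg: "\<And>j. 0 \<le> \<theta> j" and kappa_nonneg: "\<And>j. 0 \<le> \<kappa> j"
    and non_arith: "\<not> (\<exists>j0::nat. j0 > 1 \<and> (\<forall>j\<ge>1. \<kappa> j \<noteq> 0 \<longrightarrow> j0 dvd j))"
    and kappa_pos: "\<exists>j\<ge>2. \<kappa> j > 0"
begin

lemma gop1_le_gopR: "0 < r \<Longrightarrow> ereal r < grad \<kappa> \<Longrightarrow> ereal (gop \<kappa> 1 r) \<le> gopR \<kappa> 1"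
  unfolding gopR_def by (rule SUP_upper) simp

lemma gop1_le_one:
  assumes "gopR \<kappa> 1 \<le> 1" "0 < r" "ereal r < grad \<kappa>"
  shows "gop \<kappa> 1 r \<le> 1"
proof -
  have "ereal (gop \<kappa> 1 r) \<le> ereal 1"
    using gop1_le_gopR[OF assms(2,3)] assms(1) unfolding one_ereal_def by (rule order_trans)
  then show ?thesis by simp
qed

text \<open>If the limit at \<open>R\<close> is 1, a root \<open>r < R\<close> would push the
  function above its supremum between \<open>r\<close> and \<open>R\<close>. Otherwise
  \<open>rstar\<close> is the radius by definition.\<close>

lemma rstar_eq_radius:
  assumes R: "grad \<kappa> = ereal R" "0 < R" and le: "gopR \<kappa> 1 \<le> 1"
  shows "rstar \<kappa> = R"
proof (cases "gopR \<kappa> 1 = 1")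
  case True
  have "(THE r. 0 < r \<and> ereal r \<le> grad \<kappa> \<and> gop1_ext \<kappa> r = 1) = R"
  proof (rule the_equality)
    show "0 < R \<and> ereal R \<le> grad \<kappa> \<and> gop1_ext \<kappa> R = 1"
      using R True by (simp add: gop1_ext_def)
  next
    fix r assume r: "0 < r \<and> ereal r \<le> grad \<kappa> \<and> gop1_ext \<kappa> r = 1"
    show "r = R"
    proof (rule ccontr)
      assume "r \<noteq> R"
      then have "r < R" using r R by simp
      then obtain s where s: "r < s" "s < R" using dense by blast
      have "gop \<kappa> 1 r = 1" using r \<open>r < R\<close> R by (simp add: gop1_ext_def one_ereal_def)
      then have "1 < gop \<kappa> 1 s"
        using gop1_strict_mono[OF kappa_nonneg kappa_pos, of r s] r s R by simp
      moreover have "gop \<kappa> 1 s \<le> 1"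
        by (rule gop1_le_one[OF le]) (use r s R in auto)
      ultimately show False by simp
    qed
  qed
  then show ?thesis using True by (simp add: rstar_def)
next
  case False
  then show ?thesis using le R by (simp add: rstar_def)
qed

text \<open>The mass bound passes to the boundary by continuity of finite sums, and
  \<open>mass_eq\<close> holds vacuously as the series diverges beyond \<open>R\<close>.\<close>

lemma critical_radius_at_radius:
  assumes R: "grad \<kappa> = ereal R" "0 < R" and le: "gopR \<kappa> 1 \<le> 1" and \<theta>: "ereal R \<le> grad \<theta>"
  shows "critical_radius \<theta> \<kappa> (rstar \<kappa>)"
  unfolding rstar_eq_radius[OF R le]
proof
  show "0 < R" by fact
  show "(\<Sum>j=1..M. \<kappa> j * R ^ j) \<le> 1" for M
  proof (rule tendsto_upperbound)
    show "((\<lambda>s. \<Sum>j=1..M. \<kappa> j * s ^ j) \<longlongrightarrow> (\<Sum>j=1..M. \<kappa> j * R ^ j)) (at_left R)"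
      by (intro tendsto_intros)
    have "(\<Sum>j=1..M. \<kappa> j * s ^ j) \<le> 1" if "0 < s" "s < R" for s
    proof -
      have "gop \<kappa> 1 s \<le> 1" by (rule gop1_le_one[OF le]) (use that R in auto)
      then show ?thesis using sum_kappa_le_gop1[of \<kappa> s M, OF kappa_nonneg] that R by simp
    qed
    then show "\<forall>\<^sub>F s in at_left R. (\<Sum>j=1..M. \<kappa> j * s ^ j) \<le> 1"
      using eventually_at_left_real[OF R(2)] by (auto elim: eventually_mono)
  qed simp
  show "(\<lambda>M. \<Sum>j=1..M. \<kappa> j * R ^ j) \<longlonglongrightarrow> 1"
    if "R < s" "summable (\<lambda>j. \<kappa> j / real j * s ^ j)" for s
    using not_summable_real_coef[of \<kappa> s] that R by simp
  show "summable (\<lambda>j. \<theta> j / real j * s ^ j)" if "0 < s" "s < R" for s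
    using that \<theta> less_le_trans[of "ereal s" "ereal R"] by (intro summable_real_coef) auto
qed (use theta_nonneg kappa_nonneg non_arith kappa_pos in auto)

lemma critical_radius_subcritical:
  assumes gr: "grad \<theta> = grad \<kappa>" "0 < grad \<kappa>" and gt: "1 < gopR \<kappa> 1"
  shows "critical_radius \<theta> \<kappa> (rstar \<kappa>)"
proof -
  from gt obtain s0 where s0: "0 < s0" "ereal s0 < grad \<kappa>" "1 < gop \<kappa> 1 s0"
    unfolding gopR_def less_SUP_iff by (auto simp: one_ereal_def)
  obtain K where K: "s0 < K" "ereal K < grad \<kappa>"
    using ereal_dense2[OF s0(2)] by auto
  \<comment> \<open>The power series form of \<open>g_\<kappa>^{1}\<close> is continuous also at 0,
    where it vanishes, so the intermediate value theorem applies on \<open>[0, s0]\<close>.\<close>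
  define f where "f = (\<lambda>x. x * (\<Sum>n. \<kappa> (Suc n) * x ^ n))"
  have f_eq: "f x = gop \<kappa> 1 x" if "0 < x" "ereal x < grad \<kappa>" for x
  proof -
    have "(\<lambda>n. x * (\<kappa> (Suc n) * x ^ n)) sums gop \<kappa> 1 x"
      using gop1_sums[OF that] by (simp add: mult_ac)
    then have "(\<lambda>n. \<kappa> (Suc n) * x ^ n) sums (gop \<kappa> 1 x / x)"
      using sums_mult_D that by fastforce
    then show ?thesis using that by (simp add: f_def sums_iff)
  qed
  have "(\<lambda>n. K * (\<kappa> (Suc n) * K ^ n)) sums gop \<kappa> 1 K"
    using gop1_sums[of K \<kappa>] K s0 by (simp add: mult_ac)
  then have sumK: "summable (\<lambda>n. \<kappa> (Suc n) * K ^ n)"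
    using K s0 summable_mult_D[of K] by (auto simp: sums_iff)
  have "isCont f x" if "0 \<le> x" "x \<le> s0" for x
    unfolding f_def using that K
    by (intro isCont_mult continuous_ident isCont_powser[OF sumK]) auto
  then have "\<exists>x\<ge>0. x \<le> s0 \<and> f x = 1"
    using s0 f_eq[of s0] by (intro IVT) (auto simp: f_def)
  then obtain r where r: "0 \<le> r" "r \<le> s0" "f r = 1" by auto
  then have r0: "0 < r" by (cases "r = 0") (auto simp: f_def)
  have rg: "ereal r < grad \<kappa>" using r(2) s0(2) le_less_trans[of "ereal r" "ereal s0"] by simp
  have gr1: "gop \<kappa> 1 r = 1" using f_eq[OF r0 rg] r by simp
  have "(THE r. 0 < r \<and> ereal r \<le> grad \<kappa> \<and> gop1_ext \<kappa> r = 1) = r"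
  proof (rule the_equality)
    show "0 < r \<and> ereal r \<le> grad \<kappa> \<and> gop1_ext \<kappa> r = 1"
      using r0 rg gr1 by (simp add: gop1_ext_def one_ereal_def)
  next
    fix s assume s: "0 < s \<and> ereal s \<le> grad \<kappa> \<and> gop1_ext \<kappa> s = 1"
    \<comment> \<open>At the radius itself \<open>gop1_ext\<close> equals
      \<open>gopR \<kappa> 1 > 1\<close>, which rules that point out.\<close>
    then have sg: "ereal s < grad \<kappa>" using gt by (auto simp: gop1_ext_def split: if_splits)
    then have "gop \<kappa> 1 s = 1" using s by (simp add: gop1_ext_def one_ereal_def)
    then show "s = r"
      using gop1_strict_mono[OF kappa_nonneg kappa_pos, of r s]
        gop1_strict_mono[OF kappa_nonneg kappa_pos, of s r] r0 rg gr1 s sg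
      by (cases r s rule: linorder_cases) auto
  qed
  then have rstar: "rstar \<kappa> = r" using less_imp_le[OF gt] by (simp add: rstar_def)
  show ?thesis unfolding rstar
  proof
    show "0 < r" by fact
    show "(\<Sum>j=1..M. \<kappa> j * r ^ j) \<le> 1" for M
      using sum_kappa_le_gop1[of \<kappa> r M, OF kappa_nonneg r0 rg] gr1 by simp
    show "(\<lambda>M. \<Sum>j=1..M. \<kappa> j * r ^ j) \<longlonglongrightarrow> 1"
      using gop1_sums[OF r0 rg] gr1
      unfolding sums_def One_nat_def sum.atLeast1_atMost_eq by simp
    show "summable (\<lambda>j. \<theta> j / real j * s ^ j)" if "0 < s" "s < r" for s
      using that rg gr less_trans[of "ereal s" "ereal r"] by (intro summable_real_coef) auto
  qed (use theta_nonneg kappa_nonneg non_arith kappa_pos in auto)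
qed

end

text \<open>The outer radius is at least \<open>R\<close> because
  \<open>1 + \<eta> e^(i \<phi>)\<close> has real part at least 1. Points of the disc lie to the
  left of \<open>R\<close>, so the argument of \<open>z - R\<close> is at least
  \<open>pi / 2\<close> in absolute value.\<close>

lemma ball_subset_Delta0:
  assumes "0 < R" "0 < \<eta>" "0 < \<phi>" "\<phi> < pi / 2"
  shows "ball 0 R \<subseteq> Delta0 R \<eta> \<phi>"
proof
  fix z assume "z \<in> ball (0::complex) R"
  then have z: "cmod z < R" by simp
  have "1 \<le> 1 + \<eta> * cos \<phi>" using assms cos_gt_zero_pi[of \<phi>] by simp
  also have "\<dots> = Re (1 + complex_of_real \<eta> * exp (\<i> * complex_of_real \<phi>))"
    by (simp add: Re_exp)
  also have "\<dots> \<le> cmod (1 + complex_of_real \<eta> * exp (\<i> * complex_of_real \<phi>))"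
    by (rule complex_Re_le_cmod)
  finally have "R * 1 \<le> R * cmod (1 + complex_of_real \<eta> * exp (\<i> * complex_of_real \<phi>))"
    using assms by (intro mult_left_mono) auto
  then have "cmod z < R * cmod (1 + complex_of_real \<eta> * exp (\<i> * complex_of_real \<phi>))"
    using z by linarith
  moreover have "Re z < R" using z complex_Re_le_cmod[of z] by linarith
  then have "\<not> (0 < Re (z - complex_of_real R) \<or> z - complex_of_real R = 0)"
    by (auto simp: complex_eq_iff)
  then have "\<not> \<bar>Arg (z - complex_of_real R)\<bar> < pi / 2" by (simp only: Arg_Re_pos not_False_eq_True)
  ultimately show "z \<in> Delta0 R \<eta> \<phi>"
    using assms \<open>Re z < R\<close> unfolding Delta0_def by auto
qed

text \<open>Near 0 the extension agrees with the power series, which is thus its Taylor series, and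
  holomorphy on the ball bounds the radius from below. This supplies the radius of
  \<open>g_\<theta>\<close> under \<open>hyp_Sup0\<close>.\<close>

lemma grad_ge_holo_ext:
  assumes D: "ball 0 R \<subseteq> D" "0 < R" and ext: "holo_ext a D G"
  shows "ereal R \<le> grad a"
proof -
  let ?F = "Abs_fps (gcoef a)"
  have R: "fps_conv_radius ?F = grad a" by (simp add: fps_conv_radius_def grad_def)
  have pos: "0 < grad a" and hol: "G holomorphic_on ball 0 R"
    and eq: "\<And>z. z \<in> D \<Longrightarrow> ereal (cmod z) < grad a \<Longrightarrow> G z = gfun a z"
    using ext D by (auto simp: holo_ext_def intro: holomorphic_on_subset)
  have "eventually (\<lambda>z. z \<in> ball 0 R \<inter> eball 0 (grad a)) (nhds (0::complex))"
    using D pos by (intro eventually_nhds_in_open open_Int) (auto simp: zero_ereal_def[symmetric])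
  then have "eventually (\<lambda>z. eval_fps ?F z = G z) (nhds 0)"
  proof eventually_elim
    case (elim z)
    then show ?case using eq[of z] D by (auto simp: eval_fps_def gfun_def)
  qed
  then have "G has_fps_expansion ?F" using pos R by (simp add: has_fps_expansion_def)
  then have "fps_conv_radius ?F \<ge> ereal R"
    by (rule holomorphic_on_imp_fps_conv_radius_ge) (use hol in simp)
  then show ?thesis by (simp add: R)
qed

theorem theorem4p6:
  fixes \<theta> \<kappa> :: "nat \<Rightarrow> real" and m :: nat and l :: "nat \<Rightarrow> nat"
  assumes theta_nonneg: "\<And>j. 0 \<le> \<theta> j"
    and kappa_nonneg: "\<And>j. 0 \<le> \<kappa> j"
    and non_arith: "\<not> (\<exists>j0::nat. j0 > 1 \<and> (\<forall>j\<ge>1. \<kappa> j \<noteq> 0 \<longrightarrow> j0 dvd j))"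
    and kappa_pos: "\<exists>j\<ge>2. \<kappa> j > 0"
    and hyp: "hyp_Sub \<theta> \<kappa> \<or> hyp_Sup1 \<theta> \<kappa> \<or> hyp_Sup0 \<theta> \<kappa> \<or>
              hyp_Crit1 \<theta> \<kappa> \<or> hyp_Crit2 \<theta> \<kappa> \<or> hyp_Crit3 \<theta> \<kappa>"
    and ell_pos: "\<And>j. 1 \<le> j \<Longrightarrow> j \<le> m \<Longrightarrow> 1 \<le> l j"
  shows "(\<lambda>N. PN \<theta> \<kappa> N (\<lambda>\<sigma>. \<forall>j\<in>{1..m}. lexL N \<sigma> j = l j))
           \<longlonglongrightarrow> (\<Prod>j=1..m. \<kappa> (l j) * rstar \<kappa> ^ (l j))"
proof -
  note basic = theta_nonneg kappa_nonneg non_arith kappa_pos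
  \<comment> \<open>Two situations remain: a root of \<open>g_\<kappa>^{1} = 1\<close> inside the
    disc, or \<open>rstar \<kappa> = R\<close>.\<close>
  have "hyp_Sub \<theta> \<kappa> \<or> (\<exists>R. grad \<kappa> = ereal R \<and> 0 < R \<and> gopR \<kappa> 1 \<le> 1 \<and> ereal R \<le> grad \<theta>)"
  proof (cases "hyp_Sup0 \<theta> \<kappa>")
    case True
    then obtain R \<eta> \<phi> G where "grad \<kappa> = ereal R" "0 < R" "gopR \<kappa> 1 < 1"
      "0 < \<eta>" "0 < \<phi>" "\<phi> < pi / 2" "holo_ext \<theta> (Delta0 R \<eta> \<phi>) G"
      unfolding hyp_Sup0_def by blast
    then show ?thesis
      using grad_ge_holo_ext[OF ball_subset_Delta0] less_imp_le by blast
  next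
    case False
    have "\<exists>R. grad \<theta> = ereal R \<and> grad \<kappa> = ereal R \<and> 0 < R \<and> (gopR \<kappa> 1 < 1 \<or> gopR \<kappa> 1 = 1)"
      if "\<not> hyp_Sub \<theta> \<kappa>"
    proof -
      from that False hyp consider "hyp_Sup1 \<theta> \<kappa>" | "hyp_Crit1 \<theta> \<kappa>" | "hyp_Crit2 \<theta> \<kappa>" | "hyp_Crit3 \<theta> \<kappa>"
        by blast
      then show ?thesis
      proof cases
        case 1 then show ?thesis unfolding hyp_Sup1_def by blast
      next
        case 2 then show ?thesis unfolding hyp_Crit1_def by blast
      next
        case 3 then show ?thesis unfolding hyp_Crit2_def by blast
      next
        case 4 then show ?thesis unfolding hyp_Crit3_def by blast
      qed
    qed
    then show ?thesis by fastforce
  qed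
  then have "critical_radius \<theta> \<kappa> (rstar \<kappa>)"
    using critical_radius_subcritical[of \<theta> \<kappa>, OF basic]
      critical_radius_at_radius[of \<theta> \<kappa>, OF basic]
    unfolding hyp_Sub_def by blast
  then show ?thesis by (rule critical_radius.PN_lexL_tendsto) (rule ell_pos)
qed

end
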